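(* Every non-compact cocompact proper CAT(0) space is almost geodesically complete.
   Context: A CAT(0) space is a (non-empty) geodesic metric space whose geodesic triangles are no fatter than the corresponding comparison triangles in the Euclidean plane. A metric space is proper if all its closed balls are compact. A metric space $X$ is cocompact if there is a compact set $C\subset X$ such that the sets $h(C)$, with $h$ ranging over all isometries of $X$ onto itself, cover $X$ (no discrete group of isometries is assumed). A CAT(0) space $X$ is almost geodesically complete if there is a number $r\ge 0$ such that for any points $a$ and $b$ of $X$ there is a geodesic ray $\gamma:[0,\infty)\to X$ with $\gamma(0)=a$ whose image meets the open ball of radius $r$ about $b$. *)

theory Defs
  imports "HOL-Analysis.Analysis"
begin

text \<open>A metric space is rendered as a set \<open>X\<close> in a type of class \<^class>\<open>metric_space\<close>, with the
  restricted metric; \<open>X = UNIV\<close> is allowed. Geodesics are parametrised by arc length.\<close>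

definition geodesic_segment :: "'a::metric_space set \<Rightarrow> 'a set \<Rightarrow> 'a \<Rightarrow> 'a \<Rightarrow> bool" where
  "geodesic_segment X S p q \<longleftrightarrow>
     (\<exists>(\<gamma> :: real \<Rightarrow> 'a) l. 0 \<le> l \<and> \<gamma> ` {0..l} = S \<and> S \<subseteq> X \<and> \<gamma> 0 = p \<and> \<gamma> l = q \<and>
        (\<forall>s\<in>{0..l}. \<forall>t\<in>{0..l}. dist (\<gamma> s) (\<gamma> t) = \<bar>s - t\<bar>))"

definition geodesic_ray :: "'a::metric_space set \<Rightarrow> (real \<Rightarrow> 'a) \<Rightarrow> bool" where
  "geodesic_ray X \<gamma> \<longleftrightarrow>
     \<gamma> ` {0..} \<subseteq> X \<and> (\<forall>s\<in>{0..}. \<forall>t\<in>{0..}. dist (\<gamma> s) (\<gamma> t) = \<bar>s - t\<bar>)"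

definition geodesic_space :: "'a::metric_space set \<Rightarrow> bool" where
  "geodesic_space X \<longleftrightarrow> (\<forall>p\<in>X. \<forall>q\<in>X. \<exists>S. geodesic_segment X S p q)"

text \<open>The point \<open>x'\<close> of the Euclidean segment from \<open>p'\<close> to \<open>q'\<close> is the comparison point of the
  point \<open>x\<close> of the geodesic segment \<open>S\<close> from \<open>p\<close> to \<open>q\<close>.\<close>

definition comparison_point ::
  "'a::metric_space set \<Rightarrow> 'a \<Rightarrow> 'a \<Rightarrow> real^2 \<Rightarrow> real^2 \<Rightarrow> 'a \<Rightarrow> real^2 \<Rightarrow> bool" where
  "comparison_point S p q p' q' x x' \<longleftrightarrow>
     x \<in> S \<and> x' \<in> closed_segment p' q' \<and> dist p' x' = dist p x"

text \<open>The CAT(0) inequality for the geodesic triangle with vertices \<open>p, q, r\<close> and sides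
  \<open>A, B, C\<close>. The comparison triangle exists and is unique up to isometries of the plane, so it
  makes no difference whether one quantifies over all of them or picks one.\<close>

definition CAT0_triangle ::
  "'a::metric_space \<Rightarrow> 'a \<Rightarrow> 'a \<Rightarrow> 'a set \<Rightarrow> 'a set \<Rightarrow> 'a set \<Rightarrow> bool" where
  "CAT0_triangle p q r A B C \<longleftrightarrow>
     (\<forall>p' q' r' :: real^2.
        dist p' q' = dist p q \<and> dist q' r' = dist q r \<and> dist r' p' = dist r p \<longrightarrow>
        (let cmp = (\<lambda>x x'. comparison_point A p q p' q' x x' \<or>
                            comparison_point B q r q' r' x x' \<or>
                            comparison_point C r p r' p' x x')
         in \<forall>x y x' y'. cmp x x' \<and> cmp y y' \<longrightarrow> dist x y \<le> dist x' y'))"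

definition CAT0_space :: "'a::metric_space set \<Rightarrow> bool" where
  "CAT0_space X \<longleftrightarrow> X \<noteq> {} \<and> geodesic_space X \<and>
     (\<forall>p\<in>X. \<forall>q\<in>X. \<forall>r\<in>X. \<forall>A B C.
        geodesic_segment X A p q \<and> geodesic_segment X B q r \<and> geodesic_segment X C r p \<longrightarrow>
        CAT0_triangle p q r A B C)"

definition proper_space :: "'a::metric_space set \<Rightarrow> bool" where
  "proper_space X \<longleftrightarrow> (\<forall>x\<in>X. \<forall>e. compact (X \<inter> cball x e))"

definition self_isometries :: "'a::metric_space set \<Rightarrow> ('a \<Rightarrow> 'a) set" where
  "self_isometries X = {h. h ` X = X \<and> (\<forall>x\<in>X. \<forall>y\<in>X. dist (h x) (h y) = dist x y)}"

definition cocompact_space :: "'a::metric_space set \<Rightarrow> bool" where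
  "cocompact_space X \<longleftrightarrow> (\<exists>C\<subseteq>X. compact C \<and> X \<subseteq> (\<Union>h\<in>self_isometries X. h ` C))"

definition almost_geodesically_complete :: "'a::metric_space set \<Rightarrow> bool" where
  "almost_geodesically_complete X \<longleftrightarrow>
     (\<exists>r\<ge>0. \<forall>a\<in>X. \<forall>b\<in>X. \<exists>\<gamma>. geodesic_ray X \<gamma> \<and> \<gamma> 0 = a \<and> \<gamma> ` {0..} \<inter> ball b r \<noteq> {})"

end

theory Submission
  imports Defs "HOL-Library.Poly_Mapping" "HOL-Library.Z2"
begin

text \<open>Suppose that \<open>X\<close> is not almost geodesically complete. For every \<open>\<rho>\<close> there are then
  points \<open>a\<close> and \<open>b\<close> such that no ray from \<open>a\<close> comes within \<open>\<rho>\<close> of \<open>b\<close>. Since \<open>X\<close> is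
  proper, the geodesics from \<open>a\<close> that come within \<open>\<rho>\<close> of \<open>b\<close> have bounded length, as
  arbitrarily long ones would accumulate at a ray (\<open>ray_from_long_geodesics\<close>). In other words,
  the shadow that the \<open>\<rho>\<close>-ball about \<open>b\<close> casts when it is lit from \<open>a\<close> is bounded.
  Isometries carry this situation close to any prescribed point of \<open>X\<close>, so it occurs everywhere
  with the same constants (\<open>bounded_shadows\<close>). Contracting along the geodesics to \<open>a\<close> now moves
  everything far away from \<open>b\<close> to the single point \<open>a\<close> without touching the \<open>\<rho>\<close>-ball about
  \<open>b\<close>: around each of its points, \<open>X\<close> is contractible at infinity, with uniform constants.
  Euclidean space shows what is wrong with this: a top-dimensional cycle relative to the outside
  of a large ball would have to vanish near its centre.

  For general \<open>X\<close>, whose topological dimension may be infinite, dimension enters at a fixed scale.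
  Let \<open>V\<close> be a maximal \<open>1\<close>-separated subset. By cocompactness, the finite subsets of \<open>V\<close>
  with all distances at most \<open>3\<close> have at most some number \<open>m\<close> of elements. They form a simplicial
  complex (\<open>rips\<close>); its chains modulo two, augmented by the empty simplex, have a boundary
  operator \<open>\<partial>\<close>. Refining a simplex in \<open>X\<close> and rounding the result to \<open>V\<close> gives a chain map
  \<open>T\<close> (\<open>snap\<close>) of this complex to itself which moves simplices a bounded distance and
  fixes the empty simplex. Contraction to a point \<open>a\<close> gives operators \<open>D\<close> (\<open>fill\<close>)
  with \<open>\<partial> D + D \<partial> = T\<close>, and by the first paragraph, for \<open>a\<close> chosen in terms of \<open>b\<close>, no
  simplex far from \<open>b\<close> is sent by \<open>D\<close> to anything near \<open>b\<close>. Coning doubles diameters, which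
  is why simplices are refined first: since at most \<open>m + 1\<close> cones are taken on top of
  each other, a mesh of \<open>2^(-(m + 1))\<close> leads to diameters at most \<open>1\<close>, and rounding turns this
  into \<open>3\<close> again.

  The contradiction is algebraic (\<open>not_uniformly_contractible_at_infinity\<close>). By descending
  induction on \<open>k\<close> there are a bounded chain map \<open>U\<close>, a power of \<open>T\<close>, and a bounded
  operator \<open>h\<close> that raises the dimension by one, such that \<open>Q = U + \<partial> h\<close> vanishes
  on the boundaries of simplices with \<open>k + 1\<close> vertices. This is void for \<open>k = m\<close>. If it is true
  for \<open>k + 1\<close>, the coefficient at a simplex \<open>\<sigma>\<close> of \<open>Q T c = Q \<partial> D c + Q D \<partial> c = Q D \<partial> c\<close> depends
  only on \<open>\<partial> c\<close>, for any choice of the centre of \<open>D\<close>. Let \<open>h' \<tau>\<close> be the sum of all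
  \<open>\<sigma>\<close> that occur in \<open>Q D \<tau>\<close>, where the centre of \<open>D\<close> is chosen for \<open>\<sigma>\<close>; this is finite and
  bounded because \<open>D \<tau>\<close> stays away from \<open>\<sigma>\<close> when \<open>\<tau>\<close> is far from \<open>\<sigma>\<close>. Then
  \<open>h' \<partial> = Q T\<close>, whence \<open>U T + \<partial> h'\<close> vanishes on boundaries one dimension lower. For \<open>k = 0\<close> the
  empty simplex, which is the boundary of a vertex, is killed by \<open>U + \<partial> h\<close>. But \<open>U\<close> fixes it,
  and \<open>h\<close> kills it, because a bounded operator can send it nowhere: no vertex is near it.\<close>

section \<open>Chains modulo two\<close>

abbreviation keys :: "('b \<Rightarrow>\<^sub>0 bit) \<Rightarrow> 'b set" where "keys \<equiv> Poly_Mapping.keys"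
abbreviation lookup :: "('b \<Rightarrow>\<^sub>0 bit) \<Rightarrow> 'b \<Rightarrow> bit" where "lookup \<equiv> Poly_Mapping.lookup"

type_synonym 'b chain = "'b \<Rightarrow>\<^sub>0 bit"

definition gen :: "'b \<Rightarrow> 'b chain" where
  "gen x = Poly_Mapping.single x 1"

definition ext :: "('b \<Rightarrow> 'c chain) \<Rightarrow> 'b chain \<Rightarrow> 'c chain" where
  "ext f c = (\<Sum>x\<in>keys c. f x)"

lemma chain_add_self [simp]: "c + c = (0 :: 'b chain)"
proof (rule poly_mapping_eqI)
  fix k show "lookup (c + c) k = lookup 0 k"
    by (cases "lookup c k") (simp_all add: lookup_add)
qed

lemma chain_add_self_left [simp]: "c + (c + d) = (d :: 'b chain)"
  by (simp flip: add.assoc)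

text \<open>Minus is plus modulo two, and all signs disappear from the homological formulas.\<close>

lemma chain_add_moveD: "c + d = e \<Longrightarrow> c = e + (d :: 'b chain)"
  by (metis add.commute chain_add_self_left)

lemma keys_gen [simp]: "keys (gen x) = {x}"
  by (simp add: gen_def)

lemma gen_neq_0 [simp]: "gen x \<noteq> 0"
  using keys_gen by (metis empty_not_insert keys_zero)

lemma lookup_sum_chain: "lookup (sum f A) y = (\<Sum>x\<in>A. lookup (f x :: 'b chain) y)"
  by (induction A rule: infinite_finite_induct) (simp_all add: lookup_add)

lemma ext_superset:
  assumes "finite A" "keys c \<subseteq> A"
  shows "ext f c = (\<Sum>x\<in>A. if lookup c x = 1 then f x else 0)"
proof -
  have "(\<Sum>x\<in>A. if lookup c x = 1 then f x else 0) = (\<Sum>x\<in>keys c. if lookup c x = 1 then f x else 0)"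
    by (rule sum.mono_neutral_right) (use assms in \<open>auto simp: in_keys_iff\<close>)
  also have "\<dots> = ext f c"
    unfolding ext_def by (rule sum.cong) (auto simp: in_keys_iff)
  finally show ?thesis by simp
qed

lemma ext_gen [simp]: "ext f (gen x) = f x"
  by (simp add: ext_def)

lemma ext_0 [simp]: "ext f 0 = 0"
  by (simp add: ext_def)

lemma ext_add: "ext f (c + d) = ext f c + ext f d"
proof -
  let ?A = "keys c \<union> keys d"
  have "ext f (c + d) = (\<Sum>x\<in>?A. if lookup (c + d) x = 1 then f x else 0)"
    by (rule ext_superset) (use keys_add[of c d] in auto)
  also have "\<dots> = (\<Sum>x\<in>?A. (if lookup c x = 1 then f x else 0) + (if lookup d x = 1 then f x else 0))"
    by (rule sum.cong) (auto simp: lookup_add)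
  also have "\<dots> = ext f c + ext f d"
    by (simp add: sum.distrib ext_superset[of ?A])
  finally show ?thesis .
qed

lemma ext_sum: "ext f (sum g A) = (\<Sum>x\<in>A. ext f (g x))"
  by (induction A rule: infinite_finite_induct) (simp_all add: ext_add)

lemma ext_ext: "ext f (ext g c) = ext (\<lambda>x. ext f (g x)) c"
  by (simp add: ext_def[of g] ext_def[of "\<lambda>x. ext f (g x)"] ext_sum)

lemma ext_cong: "(\<And>x. x \<in> keys c \<Longrightarrow> f x = g x) \<Longrightarrow> ext f c = ext g c"
  by (simp add: ext_def)

lemma ext_add_fun: "ext (\<lambda>x. f x + g x) c = ext f c + ext g c"
  by (simp add: ext_def sum.distrib)

lemma ext_gen_self [simp]: "ext gen c = c"
proof (rule poly_mapping_eqI)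
  fix k show "lookup (ext gen c) k = lookup c k"
    by (simp add: ext_def lookup_sum_chain gen_def lookup_single when_def in_keys_iff)
qed

lemma ext_eq_0: "(\<And>x. x \<in> keys c \<Longrightarrow> f x = 0) \<Longrightarrow> ext f c = 0"
  by (simp add: ext_def)

lemma keys_sum_subset: "keys (sum f A :: 'b chain) \<subseteq> (\<Union>x\<in>A. keys (f x))"
proof (induction A rule: infinite_finite_induct)
  case (insert x A)
  then show ?case using keys_add[of "f x" "sum f A"] by auto
qed auto

lemma keys_extE:
  assumes "y \<in> keys (ext f c)"
  obtains x where "x \<in> keys c" "y \<in> keys (f x)"
  using assms keys_sum_subset[of f "keys c"] by (auto simp: ext_def)

lemma keys_addE:
  assumes "y \<in> keys (c + d :: 'b chain)"
  obtains "y \<in> keys c" | "y \<in> keys d"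
  using assms keys_add[of c d] by auto

section \<open>Lists as simplices, prisms and cones\<close>

definition cons :: "'b \<Rightarrow> 'b list chain \<Rightarrow> 'b list chain" where
  "cons x = ext (\<lambda>xs. gen (x # xs))"

lemma cons_gen [simp]: "cons x (gen xs) = gen (x # xs)"
  and cons_0 [simp]: "cons x 0 = 0"
  and cons_add: "cons x (c + d) = cons x c + cons x d"
  by (simp_all add: cons_def ext_add)

lemma ext_cons: "ext f (cons x c) = ext (\<lambda>xs. f (x # xs)) c"
  by (simp add: cons_def ext_ext)

lemma cons_ext: "cons x (ext f c) = ext (\<lambda>y. cons x (f y)) c"
  by (simp add: cons_def ext_ext)

lemma keys_consE:
  assumes "ys \<in> keys (cons x c)"
  obtains xs where "xs \<in> keys c" "ys = x # xs"
  using assms unfolding cons_def by (auto elim: keys_extE)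

text \<open>Lists of points are ordered simplices, possibly degenerate. The empty list is the simplex of
  dimension \<open>-1\<close>, so the complex is augmented and a one-element list has the empty list as
  its boundary.\<close>

fun list_bd :: "'b list \<Rightarrow> 'b list chain" where
  "list_bd [] = 0"
| "list_bd (x # xs) = gen xs + cons x (list_bd xs)"

lemma list_bd_cons: "ext list_bd (cons x c) = c + cons x (ext list_bd c)"
  by (simp add: ext_cons ext_add_fun cons_ext)

lemma list_bd_map: "list_bd (map f xs) = ext (\<lambda>ys. gen (map f ys)) (list_bd xs)"
  by (induction xs) (simp_all add: ext_add ext_cons cons_ext)

text \<open>The usual triangulation of the prism over a simplex, with \<open>f\<close> on the bottom and \<open>g\<close> on the
  top: the sum of the lists \<open>f x0, ..., f xi, g xi, ..., g xk\<close> over all \<open>i\<close>.\<close>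

fun prism :: "('b \<Rightarrow> 'c) \<Rightarrow> ('b \<Rightarrow> 'c) \<Rightarrow> 'b list \<Rightarrow> 'c list chain" where
  "prism f g [] = 0"
| "prism f g (x # xs) = gen (f x # g x # map g xs) + cons (f x) (prism f g xs)"

lemma prism_homotopy:
  "ext list_bd (prism f g xs) + ext (prism f g) (list_bd xs) = gen (map f xs) + gen (map g xs)"
proof (induction xs)
  case (Cons x xs)
  have "ext (prism f g) (cons x (list_bd xs))
      = cons (f x) (cons (g x) (list_bd (map g xs))) + cons (f x) (ext (prism f g) (list_bd xs))"
    by (simp add: ext_cons ext_add_fun cons_ext list_bd_map)
  moreover have "cons (f x) (ext list_bd (prism f g xs)) + cons (f x) (ext (prism f g) (list_bd xs))
      = gen (map f (x # xs)) + gen (f x # map g xs)"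
    using arg_cong[OF Cons.IH, of "cons (f x)"] by (simp add: cons_add)
  then have "cons (f x) (ext list_bd (prism f g xs))
      = cons (f x) (ext (prism f g) (list_bd xs)) + gen (map f (x # xs)) + gen (f x # map g xs)"
    by (simp add: chain_add_moveD add_ac)
  ultimately show ?case
    by (simp add: ext_add list_bd_cons cons_add add_ac)
qed simp

lemma keys_prism:
  assumes "zs \<in> keys (prism f g xs)"
  shows "set zs \<subseteq> f ` set xs \<union> g ` set xs" "length zs = Suc (length xs)"
  using assms
proof (induction xs arbitrary: zs)
  case (Cons x xs)
  { case 1 then show ?case using Cons.IH(1) by (fastforce elim!: keys_addE keys_consE) }
  { case 2 then show ?case using Cons.IH(2) by (auto elim!: keys_addE keys_consE) }
qed auto

text \<open>The cone with apex \<open>a\<close>, travelled in \<open>n\<close> steps by a discrete homotopy \<open>\<psi>\<close>. The first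
  summand cancels the simplex \<open>map (\<psi> 0) xs\<close> at which the homotopy starts, so that the formula below
  is exact in all dimensions; it also makes the apex the cone over the empty list.\<close>

definition cone_chain :: "'b \<Rightarrow> (nat \<Rightarrow> 'b \<Rightarrow> 'b) \<Rightarrow> nat \<Rightarrow> 'b list \<Rightarrow> 'b list chain" where
  "cone_chain a \<psi> n xs = gen (a # map (\<psi> 0) xs) + (\<Sum>k<n. prism (\<psi> k) (\<psi> (Suc k)) xs)"

lemma telescope_chain: "(\<Sum>k<n. g k + g (Suc k)) = g 0 + (g n :: 'b chain)"
  by (induction n) (simp_all add: add_ac)

lemma ext_fun_sum: "ext (\<lambda>x. \<Sum>k\<in>A. f k x) c = (\<Sum>k\<in>A. ext (f k) c)"
  unfolding ext_def by (rule sum.swap)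

text \<open>The prisms telescope, and the join with \<open>a\<close> cancels the end of the homotopy at \<open>\<psi> 0\<close>.\<close>

lemma cone_homotopy: "ext list_bd (cone_chain a \<psi> n xs) + ext (cone_chain a \<psi> n) (list_bd xs) = gen (map (\<psi> n) xs)"
proof -
  have 1: "(\<Sum>k<n. ext list_bd (prism (\<psi> k) (\<psi> (Suc k)) xs)) + (\<Sum>k<n. ext (prism (\<psi> k) (\<psi> (Suc k))) (list_bd xs))
     = gen (map (\<psi> 0) xs) + gen (map (\<psi> n) xs)"
    using telescope_chain[of "\<lambda>k. gen (map (\<psi> k) xs)" n]
    by (simp add: prism_homotopy flip: sum.distrib)
  have 2: "ext (\<lambda>xs. gen (a # map (\<psi> 0) xs)) (list_bd xs) = cons a (list_bd (map (\<psi> 0) xs))"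
    by (simp add: list_bd_map cons_ext)
  have "cone_chain a \<psi> n = (\<lambda>xs. gen (a # map (\<psi> 0) xs) + (\<Sum>k<n. prism (\<psi> k) (\<psi> (Suc k)) xs))"
    by (simp add: cone_chain_def fun_eq_iff)
  then have "ext list_bd (cone_chain a \<psi> n xs) + ext (cone_chain a \<psi> n) (list_bd xs)
     = gen (map (\<psi> 0) xs) + ((\<Sum>k<n. ext list_bd (prism (\<psi> k) (\<psi> (Suc k)) xs))
         + (\<Sum>k<n. ext (prism (\<psi> k) (\<psi> (Suc k))) (list_bd xs)))"
    by (simp add: ext_add ext_sum ext_add_fun ext_fun_sum 2 add_ac)
  then show ?thesis by (simp add: 1)
qed

lemma keys_cone:
  assumes "zs \<in> keys (cone_chain a \<psi> n xs)"
  shows "length zs = Suc (length xs)"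
    and "set zs \<subseteq> insert a (\<psi> 0 ` set xs) \<or> (\<exists>k. set zs \<subseteq> \<psi> k ` set xs \<union> \<psi> (Suc k) ` set xs)"
proof -
  have "zs = a # map (\<psi> 0) xs \<or> (\<exists>k. zs \<in> keys (prism (\<psi> k) (\<psi> (Suc k)) xs))"
    using assms unfolding cone_chain_def
  proof (rule keys_addE)
    assume "zs \<in> keys (\<Sum>k<n. prism (\<psi> k) (\<psi> (Suc k)) xs)"
    then show ?thesis
      using keys_sum_subset[of "\<lambda>k. prism (\<psi> k) (\<psi> (Suc k)) xs" "{..<n}"] by blast
  qed simp
  then consider "zs = a # map (\<psi> 0) xs" | k where "zs \<in> keys (prism (\<psi> k) (\<psi> (Suc k)) xs)"
    by blast
  then have "length zs = Suc (length xs) \<and> (set zs \<subseteq> insert a (\<psi> 0 ` set xs)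
      \<or> (\<exists>k. set zs \<subseteq> \<psi> k ` set xs \<union> \<psi> (Suc k) ` set xs))"
  proof cases
    case 1 then show ?thesis by auto
  next
    case (2 k) then show ?thesis using keys_prism[OF 2] by blast
  qed
  then show "length zs = Suc (length xs)"
    "set zs \<subseteq> insert a (\<psi> 0 ` set xs) \<or> (\<exists>k. set zs \<subseteq> \<psi> k ` set xs \<union> \<psi> (Suc k) ` set xs)"
    by blast+
qed

section \<open>Finite sets as simplices\<close>

definition set_bd :: "'b set \<Rightarrow> 'b set chain" where
  "set_bd S = (\<Sum>x\<in>S. gen (S - {x}))"

text \<open>Adding a vertex, as an exterior multiplication: it gives zero when the vertex is already there.
  With this convention \<open>join x\<close> and the boundary satisfy the formula \<open>set_bd_join\<close> on all finite
  sets.\<close>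

definition join :: "'b \<Rightarrow> 'b set \<Rightarrow> 'b set chain" where
  "join x S = (if x \<in> S then 0 else gen (insert x S))"

lemma keys_set_bdE:
  assumes "T \<in> keys (set_bd S)"
  obtains x where "x \<in> S" "T = S - {x}"
  using assms keys_sum_subset[of "\<lambda>x. gen (S - {x})" S] by (auto simp: set_bd_def)

lemma keys_joinE:
  assumes "T \<in> keys (join x S)"
  obtains "x \<notin> S" "T = insert x S"
  using assms by (auto simp: join_def split: if_splits)

lemma join_join: "ext (join x) (join x S) = 0"
  by (simp add: join_def)

lemma set_bd_join:
  assumes "finite S"
  shows "ext set_bd (join x S) + ext (join x) (set_bd S) = gen S"
proof (cases "x \<in> S")
  case True
  have "ext (join x) (set_bd S) = (\<Sum>y\<in>S. join x (S - {y}))"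
    by (simp add: set_bd_def ext_sum)
  also have "\<dots> = (\<Sum>y\<in>{x}. join x (S - {y}))"
    by (rule sum.mono_neutral_right) (use assms True in \<open>auto simp: join_def\<close>)
  finally show ?thesis
    using True by (simp add: join_def insert_absorb)
next
  case False
  have "set_bd (insert x S) = gen S + (\<Sum>y\<in>S. gen (insert x S - {y}))"
    using False assms by (simp add: set_bd_def)
  also have "(\<Sum>y\<in>S. gen (insert x S - {y})) = (\<Sum>y\<in>S. join x (S - {y}))"
    by (rule sum.cong) (use False in \<open>auto simp: join_def insert_Diff_if\<close>)
  also have "\<dots> = ext (join x) (set_bd S)"
    by (simp add: set_bd_def ext_sum)
  finally show ?thesis
    using False by (simp add: join_def add_ac)
qed

lemma set_bd_join_chain:
  assumes "\<And>S. S \<in> keys c \<Longrightarrow> finite S"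
  shows "ext set_bd (ext (join x) c) + ext (join x) (ext set_bd c) = c"
proof -
  have "ext set_bd (ext (join x) c) + ext (join x) (ext set_bd c)
      = ext (\<lambda>S. ext set_bd (join x S) + ext (join x) (set_bd S)) c"
    by (simp add: ext_ext ext_add_fun)
  also have "\<dots> = ext gen c"
    by (rule ext_cong) (simp add: set_bd_join assms)
  finally show ?thesis by simp
qed

text \<open>Write \<open>J\<close> for \<open>join x\<close>. From \<open>\<partial> J + J \<partial> = 1\<close> follows \<open>\<partial> \<partial> J = J \<partial> \<partial>\<close>, which is zero by the
  induction hypothesis; and \<open>insert x S\<close> is \<open>J\<close> applied to \<open>S\<close>.\<close>

lemma set_bd_set_bd: "finite S \<Longrightarrow> ext set_bd (set_bd S) = 0"
proof (induction S rule: finite_induct)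
  case (insert x S)
  have fin: "finite T" if "T \<in> keys (set_bd S)" for T
    using that insert.hyps by (auto elim: keys_set_bdE)
  have "set_bd (insert x S) = ext set_bd (join x S)"
    using insert.hyps by (simp add: join_def)
  also have "\<dots> = gen S + ext (join x) (set_bd S)"
    using set_bd_join[OF insert.hyps(1), of x] by (metis add.commute chain_add_self_left)
  finally have "ext set_bd (set_bd (insert x S)) = set_bd S + ext set_bd (ext (join x) (set_bd S))"
    by (simp add: ext_add)
  then show ?case
    using set_bd_join_chain[of "set_bd S" x] fin insert.IH by simp
qed (simp add: set_bd_def)

text \<open>Forgetting the order of the vertices. Lists with two equal images under \<open>q\<close> are sent to zero;
  modulo two this is a chain map, since the two faces that are left of such a list cancel.\<close>

fun proj :: "('b \<Rightarrow> 'c) \<Rightarrow> 'b list \<Rightarrow> 'c set chain" where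
  "proj q [] = gen {}"
| "proj q (x # xs) = ext (join (q x)) (proj q xs)"

lemma keys_proj:
  assumes "S \<in> keys (proj q xs)"
  shows "S = q ` set xs" "card S = length xs" "finite S"
proof -
  have "S = q ` set xs \<and> card S = length xs"
    using assms
  proof (induction xs arbitrary: S)
    case (Cons x xs)
    then show ?case by (fastforce elim!: keys_extE keys_joinE)
  qed auto
  then show "S = q ` set xs" "card S = length xs" "finite S" by auto
qed

lemma proj_cons: "ext (proj q) (cons x c) = ext (join (q x)) (ext (proj q) c)"
  by (simp add: ext_cons ext_ext)

lemma proj_list_bd: "ext (proj q) (list_bd xs) = ext set_bd (proj q xs)"
proof (induction xs)
  case (Cons x xs)
  have "ext set_bd (proj q (x # xs)) + ext (join (q x)) (ext set_bd (proj q xs)) = proj q xs"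
    unfolding proj.simps by (rule set_bd_join_chain) (erule keys_proj(3))
  then have "ext set_bd (proj q (x # xs)) = proj q xs + ext (join (q x)) (ext set_bd (proj q xs))"
    by (metis add.commute chain_add_self_left)
  then show ?case by (simp add: ext_add proj_cons Cons.IH)
qed (simp add: set_bd_def)

lemma proj_list_bd_chain: "ext (proj q) (ext list_bd c) = ext set_bd (ext (proj q) c)"
  by (simp add: ext_ext proj_list_bd)

text \<open>Every list in the prism has \<open>f x\<close> and \<open>g x\<close> as neighbours for some \<open>x\<close>, so it becomes
  degenerate.\<close>

lemma proj_prism_eq_0:
  assumes "\<And>x. x \<in> set xs \<Longrightarrow> q (f x) = q (g x)"
  shows "ext (proj q) (prism f g xs) = 0"
  using assms
proof (induction xs)
  case (Cons x xs)
  have "ext (join (q (f x))) (ext (join (q (g x))) (proj q (map g xs))) = 0"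
    using Cons.prems by (simp add: ext_ext join_join ext_eq_0)
  then show ?case using Cons by (simp add: ext_add proj_cons)
qed simp

text \<open>Once the homotopy has come to rest, further steps contribute degenerate prisms only. This makes the
  projected cone independent of the number of steps, which has to grow with the distance from the
  apex.\<close>

lemma proj_cone_stable:
  assumes "n \<le> n'" "\<And>x k. x \<in> set xs \<Longrightarrow> n \<le> k \<Longrightarrow> \<psi> k x = x"
  shows "ext (proj q) (cone_chain a \<psi> n' xs) = ext (proj q) (cone_chain a \<psi> n xs)"
proof -
  have "(\<Sum>k<n'. ext (proj q) (prism (\<psi> k) (\<psi> (Suc k)) xs))
      = (\<Sum>k<n. ext (proj q) (prism (\<psi> k) (\<psi> (Suc k)) xs))"
    by (rule sum.mono_neutral_right) (use assms in \<open>auto intro!: proj_prism_eq_0\<close>)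
  then show ?thesis by (simp add: cone_chain_def ext_add ext_sum)
qed

section \<open>The coarse complex of a uniformly discrete set\<close>

text \<open>Points of a space that are \<open>1\<close>-close have \<open>3\<close>-close roundings in a \<open>1\<close>-dense set; this is the
  reason for the constant.\<close>

definition rips :: "'v::metric_space set \<Rightarrow> 'v set set" where
  "rips V = {S. finite S \<and> S \<subseteq> V \<and> (\<forall>x\<in>S. \<forall>y\<in>S. dist x y \<le> 3)}"

lemma rips_finite: "S \<in> rips V \<Longrightarrow> finite S"
  and rips_subset: "S \<in> rips V \<Longrightarrow> S \<subseteq> V"
  and rips_dist: "S \<in> rips V \<Longrightarrow> x \<in> S \<Longrightarrow> y \<in> S \<Longrightarrow> dist x y \<le> 3"
  and rips_Diff: "S \<in> rips V \<Longrightarrow> S - A \<in> rips V"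
  by (auto simp: rips_def)

text \<open>No set is near the empty set. This matters for the empty simplex: a controlled operator
  has to send it to zero.\<close>

definition near :: "real \<Rightarrow> 'v::metric_space set \<Rightarrow> 'v set \<Rightarrow> bool" where
  "near r S S' \<longleftrightarrow> (\<exists>x\<in>S. \<exists>y\<in>S'. dist x y \<le> r)"

definition controlled ::
  "'v::metric_space set \<Rightarrow> nat \<Rightarrow> nat \<Rightarrow> ('v set \<Rightarrow> 'v set chain) \<Rightarrow> bool" where
  "controlled V k l F \<longleftrightarrow> (\<exists>r. \<forall>S\<in>rips V. card S = k \<longrightarrow>
      (\<forall>S'\<in>keys (F S). S' \<in> rips V \<and> card S' = l \<and> near r S S'))"

lemma near_mono: "near r S S' \<Longrightarrow> r \<le> r' \<Longrightarrow> near r' S S'"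
  unfolding near_def by (meson order_trans)

lemma near_trans:
  assumes "near r S S'" "near r' S' S''" "S' \<in> rips V"
  shows "near (r + 3 + r') S S''"
proof -
  obtain x y where xy: "x \<in> S" "y \<in> S'" "dist x y \<le> r"
    using assms by (auto simp: near_def)
  obtain y' z where yz: "y' \<in> S'" "z \<in> S''" "dist y' z \<le> r'"
    using assms by (auto simp: near_def)
  have "dist y y' \<le> 3" using assms xy yz by (auto intro: rips_dist)
  then have "dist x z \<le> r + 3 + r'"
    using xy yz dist_triangle[of x z y] dist_triangle[of y z y'] by linarith
  then show ?thesis using xy yz by (auto simp: near_def)
qed

lemma controlled_comp:
  assumes F: "controlled V k l F" and G: "controlled V l l' G"
  shows "controlled V k l' (\<lambda>S. ext G (F S))"
proof -
  obtain r where r: "\<And>S S'. S \<in> rips V \<Longrightarrow> card S = k \<Longrightarrow> S' \<in> keys (F S) \<Longrightarrow>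
      S' \<in> rips V \<and> card S' = l \<and> near r S S'"
    using F unfolding controlled_def by blast
  obtain r' where r': "\<And>S S'. S \<in> rips V \<Longrightarrow> card S = l \<Longrightarrow> S' \<in> keys (G S) \<Longrightarrow>
      S' \<in> rips V \<and> card S' = l' \<and> near r' S S'"
    using G unfolding controlled_def by blast
  have "S' \<in> rips V \<and> card S' = l' \<and> near (r + 3 + r') S S'"
    if S: "S \<in> rips V" "card S = k" and S': "S' \<in> keys (ext G (F S))" for S S'
  proof -
    obtain S1 where S1: "S1 \<in> keys (F S)" "S' \<in> keys (G S1)"
      using S' by (auto elim: keys_extE)
    show ?thesis
      using r[OF S S1(1)] r'[OF _ _ S1(2)] near_trans by blast
  qed
  then show ?thesis unfolding controlled_def by blast
qed

lemma controlled_add: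
  assumes F: "controlled V k l F" and G: "controlled V k l G"
  shows "controlled V k l (\<lambda>S. F S + G S)"
proof -
  obtain r where r: "\<And>S S'. S \<in> rips V \<Longrightarrow> card S = k \<Longrightarrow> S' \<in> keys (F S) \<Longrightarrow>
      S' \<in> rips V \<and> card S' = l \<and> near r S S'"
    using F unfolding controlled_def by blast
  obtain r' where r': "\<And>S S'. S \<in> rips V \<Longrightarrow> card S = k \<Longrightarrow> S' \<in> keys (G S) \<Longrightarrow>
      S' \<in> rips V \<and> card S' = l \<and> near r' S S'"
    using G unfolding controlled_def by blast
  have "S' \<in> rips V \<and> card S' = l \<and> near (max r r') S S'"
    if S: "S \<in> rips V" "card S = k" and S': "S' \<in> keys (F S + G S)" for S S'
    using S'
  proof (rule keys_addE)
    assume "S' \<in> keys (F S)"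
    then show ?thesis using r[OF S] near_mono by (metis max.cobounded1)
  next
    assume "S' \<in> keys (G S)"
    then show ?thesis using r'[OF S] near_mono by (metis max.cobounded2)
  qed
  then show ?thesis unfolding controlled_def by blast
qed

lemma controlled_set_bd: "controlled V (Suc (Suc k)) (Suc k) set_bd"
  unfolding controlled_def
proof (intro exI[of _ 0] ballI impI)
  fix S S' assume S: "S \<in> rips V" "card S = Suc (Suc k)" and "S' \<in> keys (set_bd S)"
  then obtain x where x: "x \<in> S" "S' = S - {x}" by (auto elim: keys_set_bdE)
  then have card: "card S' = Suc k" using S rips_finite by fastforce
  then obtain y where "y \<in> S'" by fastforce
  then have "near 0 S S'" using x by (auto simp: near_def)
  then show "S' \<in> rips V \<and> card S' = Suc k \<and> near 0 S S'"
    using card x S rips_Diff by blast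
qed

lemma controlled_gen: "1 \<le> k \<Longrightarrow> controlled V k k gen"
  unfolding controlled_def
proof (intro exI[of _ 0] ballI impI)
  fix S S' :: "'a set" assume "1 \<le> k" "S \<in> rips V" "card S = k" "S' \<in> keys (gen S)"
  moreover from this obtain x where "x \<in> S" by fastforce
  ultimately show "S' \<in> rips V \<and> card S' = k \<and> near 0 S S'"
    by (auto simp: near_def)
qed

lemma lookup_ext: "lookup (ext f c) y = (\<Sum>x\<in>keys c. lookup (f x) y)"
  by (simp add: ext_def lookup_sum_chain)

lemma finite_near_simplices:
  assumes "\<And>x r. finite (V \<inter> cball x r)" "finite S"
  shows "finite {S' \<in> rips V. near r S S'}"
proof (rule finite_subset)
  show "{S' \<in> rips V. near r S S'} \<subseteq> Pow (\<Union>x\<in>S. V \<inter> cball x (r + 3))"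
  proof safe
    fix S' z assume S': "S' \<in> rips V" "near r S S'" "z \<in> S'"
    then obtain x y where "x \<in> S" "y \<in> S'" "dist x y \<le> r" by (auto simp: near_def)
    then show "z \<in> (\<Union>x\<in>S. V \<inter> cball x (r + 3))"
      using S' rips_dist[OF S'(1), of y z] rips_subset[OF S'(1)] dist_triangle[of x z y]
      by (intro UN_I[of x]) auto
  qed
  show "finite (Pow (\<Union>x\<in>S. V \<inter> cball x (r + 3)))"
    using assms by blast
qed

section \<open>Descending induction on the dimension\<close>

text \<open>The cardinality \<open>k\<close> counts vertices, so \<open>k = 0\<close> belongs to the empty simplex. If \<open>U\<close> were the
  identity, the last condition would say that \<open>h\<close> is a bounded left inverse of sorts: \<open>1 + \<partial> h\<close>
  vanishes on boundaries, hence \<open>\<partial> h \<partial> = \<partial>\<close>.\<close>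

definition acyclic_above :: "'v::metric_space set \<Rightarrow> nat \<Rightarrow> bool" where
  "acyclic_above V k \<longleftrightarrow> (\<exists>U h. U {} = gen {} \<and> (\<forall>j\<ge>1. controlled V j j U) \<and>
     (\<forall>S\<in>rips V. ext set_bd (U S) = ext U (set_bd S)) \<and> controlled V k (Suc k) h \<and>
     (\<forall>S\<in>rips V. card S = Suc k \<longrightarrow> ext (\<lambda>S. U S + ext set_bd (h S)) (set_bd S) = 0))"

text \<open>Let \<open>Q = U + \<partial> h\<close>, which kills boundaries of simplices with \<open>k + 2\<close> vertices. For a simplex
  \<open>S\<close> with \<open>k + 1\<close> vertices, \<open>Q T S = Q (\<partial> D S + D \<partial> S) = Q D \<partial> S\<close> for every contraction \<open>D\<close>
  admitted by the assumption on cones. The new operator \<open>h'\<close> reads off the coefficient at \<open>\<sigma>\<close> with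
  the contraction that belongs to a vertex of \<open>\<sigma>\<close>, so that \<open>h' \<partial> = Q T\<close> on \<open>S\<close>, and
  \<open>(U T + \<partial> h') \<partial> S = \<partial> U T S + \<partial> Q T S = \<partial> \<partial> h T S = 0\<close>.\<close>

lemma acyclic_above_step:
  fixes V :: "'v::metric_space set"
  assumes locfin: "\<And>x r. finite (V \<inter> cball x r)"
    and T0: "T {} = gen {}" and Tc: "\<And>j. 1 \<le> j \<Longrightarrow> controlled V j j T"
    and Tch: "\<And>S. S \<in> rips V \<Longrightarrow> ext set_bd (T S) = ext T (set_bd S)"
    and cones: "\<And>\<rho>. \<exists>R. \<forall>b\<in>V. \<exists>D. \<forall>S\<in>rips V. ext set_bd (D S) + ext D (set_bd S) = T S \<and>
        (\<forall>S'\<in>keys (D S). S' \<in> rips V \<and> card S' = Suc (card S) \<and>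
            (\<forall>y\<in>S'. dist y b \<le> \<rho> \<longrightarrow> (\<exists>x\<in>S. dist x b \<le> R)))"
    and "acyclic_above V (Suc k)"
  shows "acyclic_above V k"
proof -
  obtain U h where U0: "U {} = gen {}" and Uc: "\<And>j. 1 \<le> j \<Longrightarrow> controlled V j j U"
    and Uch: "\<And>S. S \<in> rips V \<Longrightarrow> ext set_bd (U S) = ext U (set_bd S)"
    and hc: "controlled V (Suc k) (Suc (Suc k)) h"
    and hU: "\<And>S. S \<in> rips V \<Longrightarrow> card S = Suc (Suc k) \<Longrightarrow> ext (\<lambda>S. U S + ext set_bd (h S)) (set_bd S) = 0"
    using assms(6) unfolding acyclic_above_def by blast
  define Q where "Q S = U S + ext set_bd (h S)" for S
  have hQ: "ext Q (set_bd S) = 0" if "S \<in> rips V" "card S = Suc (Suc k)" for S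
    using hU[OF that] by (simp add: Q_def[abs_def])
  have Qc: "controlled V (Suc k) (Suc k) Q"
    unfolding Q_def using controlled_add[OF Uc controlled_comp[OF hc controlled_set_bd]] by simp
  then obtain r where r: "\<And>S S'. S \<in> rips V \<Longrightarrow> card S = Suc k \<Longrightarrow> S' \<in> keys (Q S) \<Longrightarrow>
      S' \<in> rips V \<and> card S' = Suc k \<and> near r S S'"
    unfolding controlled_def by blast
  obtain R where "\<forall>b\<in>V. \<exists>D. \<forall>S\<in>rips V. ext set_bd (D S) + ext D (set_bd S) = T S \<and>
        (\<forall>S'\<in>keys (D S). S' \<in> rips V \<and> card S' = Suc (card S) \<and>
            (\<forall>y\<in>S'. dist y b \<le> r + 3 \<longrightarrow> (\<exists>x\<in>S. dist x b \<le> R)))"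
    using cones by blast
  then obtain D where D: "\<forall>b\<in>V. \<forall>S\<in>rips V. ext set_bd (D b S) + ext (D b) (set_bd S) = T S \<and>
        (\<forall>S'\<in>keys (D b S). S' \<in> rips V \<and> card S' = Suc (card S) \<and>
            (\<forall>y\<in>S'. dist y b \<le> r + 3 \<longrightarrow> (\<exists>x\<in>S. dist x b \<le> R)))"
    by (rule bchoice[THEN exE])
  have Dh: "ext set_bd (D b S) + ext (D b) (set_bd S) = T S" if "b \<in> V" "S \<in> rips V" for b S
    using D that by blast
  have Dk: "S' \<in> rips V \<and> card S' = Suc (card S)"
    if "b \<in> V" "S \<in> rips V" "S' \<in> keys (D b S)" for b S S'
    using D that by blast
  have Dr: "\<exists>x\<in>S. dist x b \<le> R"
    if "b \<in> V" "S \<in> rips V" "S' \<in> keys (D b S)" "y \<in> S'" "dist y b \<le> r + 3" for b S S' y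
    using D that by blast
  \<comment> \<open>The location of a simplex, at which the contraction used for its coefficient is centred.\<close>
  define p where "p S = (SOME x. x \<in> S)" for S :: "'v set"
  have p: "p S \<in> S" if "card S = Suc k" for S
    unfolding p_def using that by (intro some_in_eq[THEN iffD2]) auto
  define F where "F S = {S' \<in> rips V. near R S S'} \<inter> {S'. card S' = Suc k}" for S
  have finF: "finite (F S)" if "S \<in> rips V" for S
    unfolding F_def using finite_near_simplices[OF locfin rips_finite[OF that]] by blast
  \<comment> \<open>Only simplices close to \<open>\<tau>\<close> occur in \<open>h' \<tau>\<close>: the contraction for \<open>\<sigma>\<close>
      keeps distant simplices away from \<open>\<sigma>\<close>.\<close>
  have in_F: "\<sigma> \<in> F \<tau>" if \<tau>: "\<tau> \<in> rips V" "card \<tau> = k" and \<sigma>: "\<sigma> \<in> rips V" "card \<sigma> = Suc k"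
    and k: "\<sigma> \<in> keys (ext Q (D (p \<sigma>) \<tau>))" for \<sigma> \<tau>
  proof -
    have pV: "p \<sigma> \<in> V" using p \<sigma> rips_subset by blast
    obtain \<rho> where \<rho>: "\<rho> \<in> keys (D (p \<sigma>) \<tau>)" "\<sigma> \<in> keys (Q \<rho>)" using k by (auto elim: keys_extE)
    then have "\<rho> \<in> rips V" "card \<rho> = Suc k" using Dk[OF pV \<tau>(1)] \<tau> by auto
    then have "near r \<rho> \<sigma>" using r \<rho> by blast
    then obtain x y where xy: "x \<in> \<rho>" "y \<in> \<sigma>" "dist x y \<le> r" by (auto simp: near_def)
    then have "dist x (p \<sigma>) \<le> r + 3"
      using rips_dist[OF \<sigma>(1) xy(2) p[OF \<sigma>(2)]] dist_triangle[of x "p \<sigma>" y] by linarith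
    then show ?thesis
      using Dr[OF pV \<tau>(1) \<rho>(1) xy(1)] \<sigma> p[OF \<sigma>(2)] by (auto simp: F_def near_def)
  qed
  define h' where "h' \<tau> = (\<Sum>\<sigma>\<in>F \<tau>. if \<sigma> \<in> keys (ext Q (D (p \<sigma>) \<tau>)) then gen \<sigma> else 0)" for \<tau>
  have keys_h': "\<sigma> \<in> F \<tau>" if "\<sigma> \<in> keys (h' \<tau>)" for \<sigma> \<tau>
  proof -
    have "\<sigma> \<in> (\<Union>\<sigma>'\<in>F \<tau>. keys (if \<sigma>' \<in> keys (ext Q (D (p \<sigma>') \<tau>)) then gen \<sigma>' else 0))"
      by (rule subsetD[OF keys_sum_subset that[unfolded h'_def]])
    then show ?thesis by (auto split: if_splits)
  qed
  have lookup_h': "lookup (h' \<tau>) \<sigma> = lookup (ext Q (D (p \<sigma>) \<tau>)) \<sigma>"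
    if \<tau>: "\<tau> \<in> rips V" "card \<tau> = k" and \<sigma>: "\<sigma> \<in> rips V" "card \<sigma> = Suc k" for \<sigma> \<tau>
  proof -
    have "lookup (h' \<tau>) \<sigma>
        = (\<Sum>\<sigma>'\<in>F \<tau>. if \<sigma>' = \<sigma> then (if \<sigma> \<in> keys (ext Q (D (p \<sigma>) \<tau>)) then 1 else 0) else 0)"
      unfolding h'_def lookup_sum_chain
      by (rule sum.cong) (auto simp: gen_def lookup_single when_def)
    also have "\<dots> = (if \<sigma> \<in> F \<tau> then (if \<sigma> \<in> keys (ext Q (D (p \<sigma>) \<tau>)) then 1 else 0) else 0)"
      using finF[OF \<tau>(1)] by (simp add: sum.delta)
    also have "\<dots> = lookup (ext Q (D (p \<sigma>) \<tau>)) \<sigma>"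
      using in_F[OF \<tau> \<sigma>] by (auto simp: in_keys_iff)
    finally show ?thesis .
  qed
  have h'c: "controlled V k (Suc k) h'"
    unfolding controlled_def using keys_h' by (auto simp: F_def intro!: exI[of _ R])
  have h'_set_bd: "ext h' (set_bd S) = ext Q (T S)" if S: "S \<in> rips V" "card S = Suc k" for S
  proof (rule poly_mapping_eqI)
    fix \<sigma>
    have face: "\<tau> \<in> rips V" "card \<tau> = k" if "\<tau> \<in> keys (set_bd S)" for \<tau>
      using that S rips_Diff rips_finite[OF S(1)] by (auto elim!: keys_set_bdE)
    have TS: "\<rho> \<in> rips V" "card \<rho> = Suc k" if "\<rho> \<in> keys (T S)" for \<rho>
      using Tc[of "Suc k"] S that unfolding controlled_def by auto
    show "lookup (ext h' (set_bd S)) \<sigma> = lookup (ext Q (T S)) \<sigma>"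
    proof (cases "\<sigma> \<in> rips V \<and> card \<sigma> = Suc k")
      case True
      let ?D = "D (p \<sigma>)"
      have pV: "p \<sigma> \<in> V" using p True rips_subset by blast
      have "ext Q (ext set_bd (?D S)) = 0"
        unfolding ext_ext by (rule ext_eq_0) (use Dk[OF pV S(1)] S(2) hQ in simp)
      moreover have "ext ?D (set_bd S) = T S + ext set_bd (?D S)"
        using Dh[OF pV S(1)] chain_add_moveD by (metis add.commute)
      ultimately have "ext Q (ext ?D (set_bd S)) = ext Q (T S)" by (simp add: ext_add)
      moreover have "lookup (ext h' (set_bd S)) \<sigma> = lookup (ext Q (ext ?D (set_bd S))) \<sigma>"
        unfolding ext_ext lookup_ext[of h'] lookup_ext[of "\<lambda>\<tau>. ext Q (?D \<tau>)"]
        using face lookup_h' True by (intro sum.cong) auto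
      ultimately show ?thesis by simp
    next
      case False
      have "\<sigma> \<notin> keys (ext h' (set_bd S))"
        using False keys_h' by (auto simp: F_def elim!: keys_extE)
      moreover have "\<sigma> \<notin> keys (ext Q (T S))"
        using False r TS by (blast elim: keys_extE)
      ultimately show ?thesis by (simp add: in_keys_iff)
    qed
  qed
  define U' where "U' S = ext U (T S)" for S
  have eq: "ext (\<lambda>S. U' S + ext set_bd (h' S)) (set_bd S) = 0" if S: "S \<in> rips V" "card S = Suc k" for S
  proof -
    have TS: "\<rho> \<in> rips V" "card \<rho> = Suc k" if "\<rho> \<in> keys (T S)" for \<rho>
      using Tc[of "Suc k"] S that unfolding controlled_def by auto
    have hfin: "finite \<sigma>" if "\<sigma> \<in> keys (ext h (T S))" for \<sigma>
      using that TS hc rips_finite unfolding controlled_def by (blast elim: keys_extE)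
    have "ext U' (set_bd S) = ext U (ext set_bd (T S))"
      using Tch[OF S(1)] by (simp add: U'_def[abs_def] ext_ext)
    also have "\<dots> = ext set_bd (ext U (T S))"
      unfolding ext_ext by (rule ext_cong) (use Uch TS in auto)
    finally have 1: "ext U' (set_bd S) = ext set_bd (ext U (T S))" .
    have "ext set_bd (ext set_bd (ext h (T S))) = 0"
      unfolding ext_ext[of set_bd set_bd] by (rule ext_eq_0) (use hfin set_bd_set_bd in auto)
    moreover have "ext Q (T S) = ext U (T S) + ext set_bd (ext h (T S))"
      unfolding Q_def ext_add_fun ext_ext ..
    ultimately have "ext set_bd (ext Q (T S)) = ext set_bd (ext U (T S))"
      by (simp add: ext_add)
    moreover have "ext (\<lambda>S. ext set_bd (h' S)) (set_bd S) = ext set_bd (ext h' (set_bd S))"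
      by (simp add: ext_ext)
    ultimately show ?thesis
      using 1 h'_set_bd[OF S] by (simp add: ext_add_fun)
  qed
  have "U' {} = gen {}" by (simp add: U'_def T0 U0)
  moreover have "controlled V j j U'" if "1 \<le> j" for j
    unfolding U'_def using controlled_comp[OF Tc Uc] that by blast
  moreover have "ext set_bd (U' S) = ext U' (set_bd S)" if S: "S \<in> rips V" for S
  proof (cases "S = {}")
    case True
    then show ?thesis by (simp add: U'_def T0 U0 set_bd_def)
  next
    case False
    have "card S \<ge> 1" using False rips_finite[OF S] by (simp add: Suc_le_eq card_gt_0_iff)
    then have TS: "\<rho> \<in> rips V" if "\<rho> \<in> keys (T S)" for \<rho>
      using Tc[of "card S"] S that unfolding controlled_def by auto
    have "ext set_bd (U' S) = ext U (ext set_bd (T S))"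
      unfolding U'_def ext_ext by (rule ext_cong) (use Uch TS in auto)
    then show ?thesis using Tch[OF S] by (simp add: U'_def[abs_def] ext_ext)
  qed
  ultimately show ?thesis
    unfolding acyclic_above_def using h'c eq by blast
qed

text \<open>A complex of bounded dimension and bounded geometry cannot be contracted away from every ball with
  uniform constants. The induction ends with \<open>U {} + \<partial> (h {}) = 0\<close>, where the first summand is the
  empty simplex and the second is zero.\<close>

lemma not_uniformly_contractible_at_infinity:
  fixes V :: "'v::metric_space set"
  assumes locfin: "\<And>x r. finite (V \<inter> cball x r)" and "V \<noteq> {}"
    and dim: "\<And>S. S \<in> rips V \<Longrightarrow> card S \<le> m"
    and T0: "T {} = gen {}" and Tc: "\<And>j. 1 \<le> j \<Longrightarrow> controlled V j j T"
    and Tch: "\<And>S. S \<in> rips V \<Longrightarrow> ext set_bd (T S) = ext T (set_bd S)"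
    and cones: "\<And>\<rho>. \<exists>R. \<forall>b\<in>V. \<exists>D. \<forall>S\<in>rips V. ext set_bd (D S) + ext D (set_bd S) = T S \<and>
        (\<forall>S'\<in>keys (D S). S' \<in> rips V \<and> card S' = Suc (card S) \<and>
            (\<forall>y\<in>S'. dist y b \<le> \<rho> \<longrightarrow> (\<exists>x\<in>S. dist x b \<le> R)))"
  shows False
proof -
  have "acyclic_above V m"
    unfolding acyclic_above_def
  proof (intro exI conjI)
    show "\<forall>j\<ge>1. controlled V j j gen" by (simp add: controlled_gen)
    show "controlled V m (Suc m) (\<lambda>_. 0)" by (simp add: controlled_def)
  qed (use dim in \<open>auto simp: not_less_eq_eq[symmetric] dest: dim\<close>)
  then have "acyclic_above V (m - i)" for i
  proof (induction i)
    case (Suc i)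
    show ?case
    proof (cases "i < m")
      case True
      then have "m - i = Suc (m - Suc i)" by simp
      then show ?thesis
        using acyclic_above_step[OF locfin T0 Tc Tch cones] Suc by simp
    next
      case False
      then show ?thesis using Suc by simp
    qed
  qed simp
  from this[of m] obtain U h where U: "U {} = gen {}" "controlled V 0 (Suc 0) h"
    "\<And>S. S \<in> rips V \<Longrightarrow> card S = Suc 0 \<Longrightarrow> ext (\<lambda>S. U S + ext set_bd (h S)) (set_bd S) = 0"
    unfolding acyclic_above_def by auto
  obtain v where "v \<in> V" using \<open>V \<noteq> {}\<close> by blast
  then have "U {} + ext set_bd (h {}) = 0"
    using U(3)[of "{v}"] by (simp add: rips_def set_bd_def)
  moreover have "keys (h {}) = {}"
    using U(2) unfolding controlled_def by (auto simp: rips_def near_def)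
  then have "h {} = 0" by simp
  ultimately show False using U(1) by simp
qed

section \<open>Subdividing and coning inside a space with contractions\<close>

lemma cone_homotopy_chain:
  assumes "\<And>xs x. xs \<in> keys c \<Longrightarrow> x \<in> set xs \<Longrightarrow> \<psi> n x = x"
  shows "ext list_bd (ext (cone_chain a \<psi> n) c) + ext (cone_chain a \<psi> n) (ext list_bd c) = c"
proof -
  have "ext list_bd (ext (cone_chain a \<psi> n) c) + ext (cone_chain a \<psi> n) (ext list_bd c)
      = ext (\<lambda>xs. gen (map (\<psi> n) xs)) c"
    by (simp add: ext_ext cone_homotopy flip: ext_add_fun)
  also have "\<dots> = ext gen c"
    by (rule ext_cong) (simp add: assms map_idI)
  finally show ?thesis by simp
qed

text \<open>What is used of a CAT(0) space: every point \<open>a\<close> is the end of a discrete homotopy \<open>\<psi> a\<close>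
  of \<open>1\<close>-Lipschitz maps with steps of length \<open>\<delta>\<close>, which starts at the constant map, moves along
  geodesics from \<open>a\<close> and eventually rests at the identity on each bounded set.\<close>

locale net_with_contractions =
  fixes X V :: "'a::metric_space set" and q :: "'a \<Rightarrow> 'a" and \<psi> :: "'a \<Rightarrow> nat \<Rightarrow> 'a \<Rightarrow> 'a"
    and m :: nat and \<delta> :: real
  assumes V_X: "V \<subseteq> X"
    and q_in: "x \<in> X \<Longrightarrow> q x \<in> V" and dist_q: "x \<in> X \<Longrightarrow> dist x (q x) \<le> 1"
    and dim: "S \<in> rips V \<Longrightarrow> card S \<le> m"
    and \<delta>_pos: "0 < \<delta>" and \<delta>_small: "2 ^ Suc m * \<delta> \<le> 1"
    and \<psi>_in: "a \<in> X \<Longrightarrow> x \<in> X \<Longrightarrow> \<psi> a k x \<in> X"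
    and \<psi>_0: "a \<in> X \<Longrightarrow> x \<in> X \<Longrightarrow> \<psi> a 0 x = a"
    and \<psi>_lipschitz: "a \<in> X \<Longrightarrow> x \<in> X \<Longrightarrow> y \<in> X \<Longrightarrow> dist (\<psi> a k x) (\<psi> a k y) \<le> dist x y"
    and \<psi>_step: "a \<in> X \<Longrightarrow> x \<in> X \<Longrightarrow> dist (\<psi> a k x) (\<psi> a (Suc k) x) \<le> \<delta>"
    and \<psi>_between: "a \<in> X \<Longrightarrow> x \<in> X \<Longrightarrow> dist a (\<psi> a k x) + dist (\<psi> a k x) x = dist a x"
    and \<psi>_end: "a \<in> X \<Longrightarrow> x \<in> X \<Longrightarrow> dist a x \<le> \<delta> * real k \<Longrightarrow> \<psi> a k x = x"
begin

definition small :: "real \<Rightarrow> 'a list \<Rightarrow> bool" where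
  "small e xs \<longleftrightarrow> set xs \<subseteq> X \<and> (\<forall>x\<in>set xs. \<forall>y\<in>set xs. dist x y \<le> e)"

lemma small_mono: "small e xs \<Longrightarrow> e \<le> e' \<Longrightarrow> small e' xs"
  unfolding small_def by (meson order_trans)

lemma cone_points:
  assumes "zs \<in> keys (cone_chain a (\<psi> a) n xs)" "z \<in> set zs"
  shows "z = a \<or> (\<exists>k. \<exists>x\<in>set xs. z = \<psi> a k x)"
  using keys_cone(2)[OF assms(1)] assms(2) by blast

text \<open>In the prism between two consecutive maps, distances are at most \<open>e + \<delta>\<close>. The first summand of the
  cone is the constant list \<open>a\<close>.\<close>

lemma cone_small:
  assumes a: "a \<in> X" and xs: "small e xs" and e: "\<delta> \<le> e" and zs: "zs \<in> keys (cone_chain a (\<psi> a) n xs)"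
  shows "small (2 * e) zs"
proof -
  have X: "x \<in> X" if "x \<in> set xs" for x using xs that by (auto simp: small_def)
  have in_X: "set zs \<subseteq> X"
    using cone_points[OF zs] a X \<psi>_in by blast
  have d: "dist (\<psi> a k x) (\<psi> a k y) \<le> e" if "x \<in> set xs" "y \<in> set xs" for k x y
  proof -
    have "dist x y \<le> e" using xs that by (auto simp: small_def)
    then show ?thesis using \<psi>_lipschitz[OF a X[OF that(1)] X[OF that(2)], of k] by linarith
  qed
  have d1: "dist (\<psi> a k x) (\<psi> a (Suc k) y) \<le> 2 * e" if "x \<in> set xs" "y \<in> set xs" for k x y
    using d[OF that, of k] \<psi>_step[OF a X[OF that(2)], of k] e
      dist_triangle[of "\<psi> a k x" "\<psi> a (Suc k) y" "\<psi> a k y"] by linarith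
  have "dist z w \<le> 2 * e" if zw: "z \<in> set zs" "w \<in> set zs" for z w
    using keys_cone(2)[OF zs]
  proof (elim disjE exE)
    assume "set zs \<subseteq> insert a (\<psi> a 0 ` set xs)"
    also have "\<dots> \<subseteq> {a}" using \<psi>_0[OF a X] by auto
    finally have "z = a" "w = a" using zw by auto
    then show ?thesis using e \<delta>_pos by simp
  next
    fix k assume "set zs \<subseteq> \<psi> a k ` set xs \<union> \<psi> a (Suc k) ` set xs"
    then obtain x y where xy: "x \<in> set xs" "y \<in> set xs"
      "z = \<psi> a k x \<or> z = \<psi> a (Suc k) x" "w = \<psi> a k y \<or> w = \<psi> a (Suc k) y"
      using zw by blast
    have "e \<le> 2 * e" using e \<delta>_pos by simp
    then show ?thesis
      using xy d[OF xy(1,2), of k] d[OF xy(1,2), of "Suc k"] d1[OF xy(1,2), of k]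
        d1[OF xy(2,1), of k] by (auto simp: dist_commute)
  qed
  then show ?thesis using in_X by (simp add: small_def)
qed

text \<open>Enough steps of length \<open>\<delta>\<close> to reach everything that occurs in the subdivision of a simplex.\<close>

definition steps :: nat where
  "steps = nat \<lceil>(6 * real m + 6) / \<delta>\<rceil>"

lemma steps: "6 * real m + 6 \<le> \<delta> * real steps"
proof -
  have "(6 * real m + 6) / \<delta> \<le> real steps"
    unfolding steps_def by (rule real_nat_ceiling_ge)
  then show ?thesis using \<delta>_pos by (simp add: field_simps)
qed

definition base :: "'a set \<Rightarrow> 'a" where
  "base S = (SOME x. x \<in> S)"

text \<open>Subdivision by induction on the skeleta: the subdivided boundary of a simplex is a cycle, and it is
  filled by its cone from a vertex. Every cone doubles the mesh, which is
  \<open>\<delta>\<close> at the outset, so the choice of \<open>\<delta>\<close> in terms of the dimension keeps the result fine.\<close>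

primrec subdivide :: "nat \<Rightarrow> 'a set \<Rightarrow> 'a list chain" where
  "subdivide 0 S = gen []"
| "subdivide (Suc k) S = ext (cone_chain (base S) (\<psi> (base S)) steps) (ext (subdivide k) (set_bd S))"

lemma base_in: "card S = Suc k \<Longrightarrow> base S \<in> S"
  unfolding base_def by (intro some_in_eq[THEN iffD2]) auto

lemma face:
  assumes "S \<in> rips V" "card S = Suc k" "S' \<in> keys (set_bd S)"
  shows "S' \<in> rips V" "card S' = k" "S' \<subseteq> S"
  using assms rips_Diff rips_finite[OF assms(1)] by (auto elim!: keys_set_bdE)

lemma subdivide_keys:
  assumes "S \<in> rips V" "card S = k" "xs \<in> keys (subdivide k S)"
  shows "length xs = k \<and> small (2 ^ k * \<delta>) xs \<and> (\<forall>x\<in>set xs. \<forall>v\<in>S. dist v x \<le> 6 * real k)"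
  using assms
proof (induction k arbitrary: S xs)
  case 0
  then show ?case by (simp add: small_def)
next
  case (Suc k)
  let ?a = "base S"
  have aS: "?a \<in> S" using Suc.prems base_in by blast
  then have aX: "?a \<in> X" using Suc.prems V_X rips_subset by blast
  obtain ys where ys: "ys \<in> keys (ext (subdivide k) (set_bd S))" "xs \<in> keys (cone_chain ?a (\<psi> ?a) steps ys)"
    using Suc.prems(3) by (auto elim: keys_extE)
  then obtain S' where S': "S' \<in> keys (set_bd S)" "ys \<in> keys (subdivide k S')" by (auto elim: keys_extE)
  note f = face[OF Suc.prems(1,2) S'(1)]
  have IH: "length ys = k" "small (2 ^ k * \<delta>) ys" "\<And>x v. x \<in> set ys \<Longrightarrow> v \<in> S' \<Longrightarrow> dist v x \<le> 6 * real k"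
    using Suc.IH[OF f(1,2) S'(2)] by auto
  have "small (2 * (2 ^ k * \<delta>)) xs"
    using cone_small[OF aX IH(2) _ ys(2)] \<delta>_pos by simp
  moreover have "length xs = Suc k" using keys_cone(1)[OF ys(2)] IH(1) by simp
  moreover have "dist v z \<le> 6 * real (Suc k)" if z: "z \<in> set xs" and v: "v \<in> S" for z v
  proof -
    have va: "dist v ?a \<le> 3" using rips_dist[OF Suc.prems(1) v aS] .
    consider "z = ?a" | j x where "x \<in> set ys" "z = \<psi> ?a j x"
      using cone_points[OF ys(2) z] by blast
    then show ?thesis
    proof cases
      case 1 then show ?thesis using va by simp
    next
      case (2 j x)
      have xX: "x \<in> X" using 2 IH(2) by (auto simp: small_def)
      have "S' \<noteq> {}" using 2 IH(1) f(2) by auto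
      then obtain u where u: "u \<in> S'" by blast
      have "dist ?a x \<le> 3 + 6 * real k"
        using IH(3)[OF 2(1) u] rips_dist[OF Suc.prems(1) aS, of u] u f(3) dist_triangle[of ?a x u] by force
      moreover have "dist ?a z \<le> dist ?a x"
        using \<psi>_between[OF aX xX, of j, folded 2(2)] zero_le_dist[of z x] by linarith
      ultimately show ?thesis using va dist_triangle[of v z ?a] by simp
    qed
  qed
  ultimately show ?case by (simp add: mult.assoc)
qed

lemma subdivide_boundary:
  "S \<in> rips V \<Longrightarrow> card S = Suc k \<Longrightarrow> ext list_bd (subdivide (Suc k) S) = ext (subdivide k) (set_bd S)"
proof (induction k arbitrary: S)
  case (0 S)
  have "ext list_bd (ext (subdivide 0) (set_bd S)) = 0"
    unfolding ext_ext by (rule ext_eq_0) simp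
  moreover have "xs = []" if "xs \<in> keys (ext (subdivide 0) (set_bd S))" for xs
    using that by (auto elim: keys_extE)
  ultimately show ?case
    using cone_homotopy_chain[of "ext (subdivide 0) (set_bd S)" "\<psi> (base S)" steps "base S"]
    by (fastforce simp del: subdivide.simps(1))
next
  case (Suc k S)
  let ?a = "base S" and ?c = "ext (subdivide (Suc k)) (set_bd S)"
  have aS: "?a \<in> S" using Suc.prems base_in by blast
  then have aX: "?a \<in> X" using Suc.prems V_X rips_subset by blast
  have "ext list_bd ?c = ext (\<lambda>S'. ext (subdivide k) (set_bd S')) (set_bd S)"
    unfolding ext_ext by (rule ext_cong) (use Suc.IH face[OF Suc.prems] in blast)
  also have "\<dots> = ext (subdivide k) (ext set_bd (set_bd S))" by (simp add: ext_ext)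
  also have "\<dots> = 0" using set_bd_set_bd[OF rips_finite[OF Suc.prems(1)]] by simp
  finally have 0: "ext list_bd ?c = 0" .
  have "\<psi> ?a steps x = x" if xs: "xs \<in> keys ?c" and x: "x \<in> set xs" for xs x
  proof -
    obtain S' where S': "S' \<in> keys (set_bd S)" "xs \<in> keys (subdivide (Suc k) S')" using xs by (auto elim: keys_extE)
    note f = face[OF Suc.prems S'(1)]
    note k = subdivide_keys[OF f(1,2) S'(2)]
    have "x \<in> X" using k x by (auto simp: small_def)
    obtain u where u: "u \<in> S'" using f(2) by fastforce
    have "Suc k \<le> m" using dim[OF f(1)] f(2) by simp
    then have "6 * real (Suc k) \<le> 6 * real m" by simp
    moreover have "dist u x \<le> 6 * real (Suc k)" using k x u by blast
    moreover have "dist ?a u \<le> 3" using rips_dist[OF Suc.prems(1) aS] u f(3) by blast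
    ultimately have "dist ?a x \<le> 6 * real m + 6" using dist_triangle[of ?a x u] by linarith
    then show ?thesis using \<psi>_end[OF aX \<open>x \<in> X\<close>] steps by simp
  qed
  then have "ext list_bd (ext (cone_chain ?a (\<psi> ?a) steps) ?c)
      + ext (cone_chain ?a (\<psi> ?a) steps) (ext list_bd ?c) = ?c"
    by (rule cone_homotopy_chain)
  then show ?case unfolding subdivide.simps(2)[of "Suc k"] 0 ext_0 by (simp del: subdivide.simps)
qed

definition subdivision :: "'a set \<Rightarrow> 'a list chain" where
  "subdivision S = subdivide (card S) S"

lemma subdivision_keys:
  assumes "S \<in> rips V" "xs \<in> keys (subdivision S)"
  shows "length xs = card S" "small (2 ^ m * \<delta>) xs" "\<And>x v. x \<in> set xs \<Longrightarrow> v \<in> S \<Longrightarrow> dist v x \<le> 6 * real m"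
proof -
  have k: "card S \<le> m" using dim assms by blast
  have "length xs = card S \<and> small (2 ^ card S * \<delta>) xs \<and> (\<forall>x\<in>set xs. \<forall>v\<in>S. dist v x \<le> 6 * real (card S))"
    using subdivide_keys[OF assms(1) refl] assms(2) by (simp add: subdivision_def)
  moreover have "2 ^ card S * \<delta> \<le> 2 ^ m * \<delta>" using k \<delta>_pos by simp
  moreover have "6 * real (card S) \<le> 6 * real m" using k by simp
  ultimately show "length xs = card S" "small (2 ^ m * \<delta>) xs"
    "\<And>x v. x \<in> set xs \<Longrightarrow> v \<in> S \<Longrightarrow> dist v x \<le> 6 * real m"
    using small_mono by (blast, blast, meson order_trans)
qed

lemma subdivision_boundary:
  assumes "S \<in> rips V"
  shows "ext list_bd (subdivision S) = ext subdivision (set_bd S)"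
proof (cases "card S")
  case 0
  then have "S = {}" using rips_finite[OF assms] by simp
  then show ?thesis by (simp add: subdivision_def set_bd_def)
next
  case (Suc k)
  have "ext subdivision (set_bd S) = ext (subdivide k) (set_bd S)"
    by (rule ext_cong) (use face(2)[OF assms Suc] in \<open>auto simp: subdivision_def\<close>)
  then show ?thesis using subdivide_boundary[OF assms Suc] Suc by (simp add: subdivision_def del: subdivide.simps)
qed

lemma proj_small:
  assumes xs: "small 1 xs" and S': "S' \<in> keys (proj q xs)"
  shows "S' \<in> rips V" "card S' = length xs" "S' = q ` set xs"
proof -
  note p = keys_proj[OF S']
  have X: "x \<in> X" if "x \<in> set xs" for x using xs that by (auto simp: small_def)
  have "dist (q x) (q y) \<le> 3" if "x \<in> set xs" "y \<in> set xs" for x y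
  proof -
    have "dist x y \<le> 1" using xs that by (auto simp: small_def)
    then show ?thesis
      using dist_q[OF X[OF that(1)]] dist_q[OF X[OF that(2)]] dist_commute[of x "q x"]
        dist_triangle[of "q x" "q y" x] dist_triangle[of x "q y" y] by linarith
  qed
  then show "S' \<in> rips V" using p q_in X by (auto simp: rips_def)
qed (use keys_proj[OF S'] in auto)

text \<open>The chain map of the coarse complex induced by the identity of the space. It need not be
  the identity, only to be bounded and to fix the empty simplex.\<close>

definition snap :: "'a set \<Rightarrow> 'a set chain" where
  "snap S = ext (proj q) (subdivision S)"

lemma snap_empty: "snap {} = gen {}"
  by (simp add: snap_def subdivision_def)

lemma snap_boundary:
  assumes "S \<in> rips V"
  shows "ext set_bd (snap S) = ext snap (set_bd S)"
proof -
  have "ext set_bd (snap S) = ext (proj q) (ext list_bd (subdivision S))"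
    by (simp add: snap_def proj_list_bd_chain)
  then show ?thesis by (simp add: subdivision_boundary[OF assms] ext_ext snap_def[abs_def])
qed

lemma two_pow_\<delta>: "2 ^ m * \<delta> \<le> 1"
proof -
  have "2 ^ m * \<delta> \<le> 2 ^ Suc m * \<delta>" using \<delta>_pos by simp
  then show ?thesis using \<delta>_small by linarith
qed

lemma controlled_snap:
  assumes "1 \<le> j"
  shows "controlled V j j snap"
  unfolding controlled_def
proof (intro exI[of _ "6 * real m + 1"] ballI impI)
  fix S S' assume S: "S \<in> rips V" "card S = j" "S' \<in> keys (snap S)"
  then obtain xs where xs: "xs \<in> keys (subdivision S)" "S' \<in> keys (proj q xs)"
    by (auto simp: snap_def elim: keys_extE)
  note k = subdivision_keys[OF S(1) xs(1)]
  note p = proj_small[OF small_mono[OF k(2) two_pow_\<delta>] xs(2)]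
  have "S \<noteq> {}" "xs \<noteq> []" using S assms k(1) by auto
  then obtain v x where v: "v \<in> S" and x: "x \<in> set xs" by fastforce
  have "x \<in> X" using k(2) x by (auto simp: small_def)
  then have "dist v (q x) \<le> 6 * real m + 1"
    using k(3)[OF x v] dist_q dist_triangle[of v "q x" x] by force
  then have "near (6 * real m + 1) S S'" using v x p(3) by (auto simp: near_def)
  then show "S' \<in> rips V \<and> card S' = j \<and> near (6 * real m + 1) S S'"
    using p k(1) S(2) by simp
qed

definition reach :: "'a \<Rightarrow> 'a set \<Rightarrow> nat" where
  "reach a S = (SOME n. \<forall>xs\<in>keys (subdivision S). \<forall>x\<in>set xs. dist a x \<le> \<delta> * real n)"

lemma reach:
  assumes "xs \<in> keys (subdivision S)" "x \<in> set xs"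
  shows "dist a x \<le> \<delta> * real (reach a S)"
proof -
  let ?P = "\<Union>xs\<in>keys (subdivision S). set xs"
  have "finite ?P" by simp
  then obtain r where r: "\<And>x. x \<in> ?P \<Longrightarrow> dist a x \<le> r"
    using finite_imp_bounded bounded_any_center[of ?P a] by blast
  have "r \<le> \<delta> * real (nat \<lceil>r / \<delta>\<rceil>)"
    using real_nat_ceiling_ge[of "r / \<delta>"] \<delta>_pos by (simp add: field_simps)
  then have "\<exists>n. \<forall>xs\<in>keys (subdivision S). \<forall>x\<in>set xs. dist a x \<le> \<delta> * real n"
    using r by (meson UN_I order_trans)
  then have "\<forall>xs\<in>keys (subdivision S). \<forall>x\<in>set xs. dist a x \<le> \<delta> * real (reach a S)"
    unfolding reach_def by (rule someI_ex)
  then show ?thesis using assms by blast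
qed

text \<open>The contraction to \<open>a\<close>. The number of steps depends on the simplex, which destroys linearity of the
  homotopy formula for lists; after projection the choice is immaterial by \<open>fill_stable\<close>.\<close>

definition fill :: "'a \<Rightarrow> 'a set \<Rightarrow> 'a set chain" where
  "fill a S = ext (proj q) (ext (cone_chain a (\<psi> a) (reach a S)) (subdivision S))"

lemma fill_stable:
  assumes a: "a \<in> X" and S: "S \<in> rips V" and n: "reach a S \<le> n"
  shows "fill a S = ext (proj q) (ext (cone_chain a (\<psi> a) n) (subdivision S))"
  unfolding fill_def ext_ext
proof (rule ext_cong)
  fix xs assume xs: "xs \<in> keys (subdivision S)"
  have "\<psi> a k x = x" if x: "x \<in> set xs" and k: "reach a S \<le> k" for x k
  proof -
    have "x \<in> X" using subdivision_keys(2)[OF S xs] x by (auto simp: small_def)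
    moreover have "\<delta> * real (reach a S) \<le> \<delta> * real k" using k \<delta>_pos by simp
    ultimately show ?thesis using \<psi>_end[OF a] reach[OF xs x, of a] by simp
  qed
  then show "ext (proj q) (cone_chain a (\<psi> a) (reach a S) xs) = ext (proj q) (cone_chain a (\<psi> a) n xs)"
    by (rule proj_cone_stable[OF n, symmetric])
qed

text \<open>Both sides are computed with one number of steps that is large enough for \<open>S\<close> and all its faces.\<close>

lemma fill_boundary:
  assumes a: "a \<in> X" and S: "S \<in> rips V"
  shows "ext set_bd (fill a S) + ext (fill a) (set_bd S) = snap S"
proof -
  define n where "n = reach a S + (\<Sum>S'\<in>keys (set_bd S). reach a S')"
  let ?C = "cone_chain a (\<psi> a) n"
  have 1: "fill a S = ext (proj q) (ext ?C (subdivision S))"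
    by (rule fill_stable[OF a S]) (simp add: n_def)
  have "ext (fill a) (set_bd S) = ext (\<lambda>S'. ext (proj q) (ext ?C (subdivision S'))) (set_bd S)"
  proof (rule ext_cong)
    fix S' assume S': "S' \<in> keys (set_bd S)"
    have "reach a S' \<le> (\<Sum>S'\<in>keys (set_bd S). reach a S')"
      by (rule member_le_sum) (use S' in auto)
    then show "fill a S' = ext (proj q) (ext ?C (subdivision S'))"
      using S' S rips_Diff by (intro fill_stable[OF a]) (auto simp: n_def elim: keys_set_bdE)
  qed
  also have "\<dots> = ext (proj q) (ext ?C (ext list_bd (subdivision S)))"
    by (simp add: subdivision_boundary[OF S] ext_ext)
  finally have "ext set_bd (fill a S) + ext (fill a) (set_bd S)
      = ext (proj q) (ext list_bd (ext ?C (subdivision S)) + ext ?C (ext list_bd (subdivision S)))"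
    by (simp add: 1 ext_add proj_list_bd_chain)
  also have "ext list_bd (ext ?C (subdivision S)) + ext ?C (ext list_bd (subdivision S)) = subdivision S"
  proof (rule cone_homotopy_chain)
    fix xs x assume xs: "xs \<in> keys (subdivision S)" and x: "x \<in> set xs"
    have "x \<in> X" using subdivision_keys(2)[OF S xs] x by (auto simp: small_def)
    moreover have "\<delta> * real (reach a S) \<le> \<delta> * real n"
      using \<delta>_pos by (intro mult_left_mono) (simp_all add: n_def del: of_nat_add of_nat_sum)
    ultimately show "\<psi> a n x = x" using \<psi>_end[OF a] reach[OF xs x, of a] by simp
  qed
  finally show ?thesis by (simp add: snap_def)
qed

lemma fill_keys:
  assumes a: "a \<in> X" and S: "S \<in> rips V" and S': "S' \<in> keys (fill a S)"
  shows "S' \<in> rips V \<and> card S' = Suc (card S)"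
    and "y \<in> S' \<Longrightarrow> \<exists>z\<in>X. dist z y \<le> 1 \<and>
       (z = a \<or> (\<exists>x\<in>X. dist a z + dist z x = dist a x \<and> (\<exists>v\<in>S. dist v x \<le> 6 * real m)))"
proof -
  obtain zs where zs: "zs \<in> keys (ext (cone_chain a (\<psi> a) (reach a S)) (subdivision S))" "S' \<in> keys (proj q zs)"
    using S' by (auto simp: fill_def elim: keys_extE)
  then obtain xs where xs: "xs \<in> keys (subdivision S)" "zs \<in> keys (cone_chain a (\<psi> a) (reach a S) xs)"
    by (auto elim: keys_extE)
  note k = subdivision_keys[OF S xs(1)]
  have "1 * \<delta> \<le> 2 ^ m * \<delta>" using \<delta>_pos by (intro mult_right_mono) auto
  then have "small (2 * (2 ^ m * \<delta>)) zs" using cone_small[OF a k(2) _ xs(2)] by simp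
  then have small: "small 1 zs" using small_mono \<delta>_small by simp
  note p = proj_small[OF small zs(2)]
  show "S' \<in> rips V \<and> card S' = Suc (card S)"
    using p k(1) keys_cone(1)[OF xs(2)] by simp
  assume "y \<in> S'"
  then obtain z where z: "z \<in> set zs" "y = q z" using p by blast
  have zX: "z \<in> X" using small z by (auto simp: small_def)
  have "z = a \<or> (\<exists>x\<in>X. dist a z + dist z x = dist a x \<and> (\<exists>v\<in>S. dist v x \<le> 6 * real m))"
  proof (rule disjCI)
    assume "\<not> (\<exists>x\<in>X. dist a z + dist z x = dist a x \<and> (\<exists>v\<in>S. dist v x \<le> 6 * real m))"
    moreover {
      fix j x assume x: "x \<in> set xs" "z = \<psi> a j x"
      have xX: "x \<in> X" using k(2) x by (auto simp: small_def)
      have "S \<noteq> {}" using x(1) k(1) by auto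
      then obtain v where "v \<in> S" by blast
      then have "\<exists>x\<in>X. dist a z + dist z x = dist a x \<and> (\<exists>v\<in>S. dist v x \<le> 6 * real m)"
        using \<psi>_between[OF a xX, of j] k(3)[OF x(1)] xX x by blast
    }
    ultimately show "z = a" using cone_points[OF xs(2) z(1)] by blast
  qed
  then show "\<exists>z\<in>X. dist z y \<le> 1 \<and>
       (z = a \<or> (\<exists>x\<in>X. dist a z + dist z x = dist a x \<and> (\<exists>v\<in>S. dist v x \<le> 6 * real m)))"
    using dist_q[OF zX] z zX by blast
qed

text \<open>A vertex of \<open>fill a S\<close> is within \<open>1\<close> of \<open>a\<close> or of a point \<open>z\<close> between \<open>a\<close> and some \<open>x\<close> close
  to \<open>S\<close>. If it is also near \<open>b\<close>, the light from \<open>a\<close> to \<open>x\<close> passes the ball about \<open>b\<close>, so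
  \<open>x\<close> and hence \<open>S\<close> are in the bounded shadow.\<close>

lemma no_bounded_shadows:
  assumes "\<And>x r. finite (V \<inter> cball x r)" and "V \<noteq> {}"
    and shadows: "\<And>\<rho>. \<exists>R. \<forall>b\<in>X. \<exists>a\<in>X. \<rho> < dist a b \<and>
       (\<forall>x\<in>X. R < dist x b \<longrightarrow> (\<forall>y\<in>X. dist a y + dist y x = dist a x \<longrightarrow> \<rho> < dist y b))"
  shows False
proof (rule not_uniformly_contractible_at_infinity[OF assms(1,2) dim snap_empty controlled_snap snap_boundary])
  fix \<rho> :: real
  obtain R where R: "\<forall>b\<in>X. \<exists>a\<in>X. \<rho> + 1 < dist a b \<and>
       (\<forall>x\<in>X. R < dist x b \<longrightarrow> (\<forall>y\<in>X. dist a y + dist y x = dist a x \<longrightarrow> \<rho> + 1 < dist y b))"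
    using shadows by blast
  show "\<exists>R. \<forall>b\<in>V. \<exists>D. \<forall>S\<in>rips V. ext set_bd (D S) + ext D (set_bd S) = snap S \<and>
        (\<forall>S'\<in>keys (D S). S' \<in> rips V \<and> card S' = Suc (card S) \<and>
            (\<forall>y\<in>S'. dist y b \<le> \<rho> \<longrightarrow> (\<exists>x\<in>S. dist x b \<le> R)))"
  proof (intro exI[of _ "R + 6 * real m"] ballI)
    fix b assume "b \<in> V"
    then have "b \<in> X" using V_X by blast
    then obtain a where a: "a \<in> X" "\<rho> + 1 < dist a b"
      and miss: "\<And>x y. x \<in> X \<Longrightarrow> R < dist x b \<Longrightarrow> y \<in> X \<Longrightarrow> dist a y + dist y x = dist a x \<Longrightarrow> \<rho> + 1 < dist y b"
      using R by blast
    have "\<exists>v\<in>S. dist v b \<le> R + 6 * real m"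
      if S: "S \<in> rips V" "S' \<in> keys (fill a S)" "y \<in> S'" "dist y b \<le> \<rho>" for S S' y
    proof -
      obtain z where z: "z \<in> X" "dist z y \<le> 1"
        "z = a \<or> (\<exists>x\<in>X. dist a z + dist z x = dist a x \<and> (\<exists>v\<in>S. dist v x \<le> 6 * real m))"
        using fill_keys(2)[OF a(1) S(1-3)] by blast
      have zb: "dist z b \<le> \<rho> + 1" using z(2) S(4) dist_triangle[of z b y] by linarith
      then have "z \<noteq> a" using a by auto
      then obtain x v where x: "x \<in> X" "dist a z + dist z x = dist a x" "v \<in> S" "dist v x \<le> 6 * real m"
        using z(3) by blast
      have "dist x b \<le> R" using miss[OF x(1) _ z(1) x(2)] zb by force
      then show ?thesis using x dist_triangle[of v b x] by (intro bexI[of _ v]) auto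
    qed
    note close = this
    show "\<exists>D. \<forall>S\<in>rips V. ext set_bd (D S) + ext D (set_bd S) = snap S \<and>
        (\<forall>S'\<in>keys (D S). S' \<in> rips V \<and> card S' = Suc (card S) \<and>
            (\<forall>y\<in>S'. dist y b \<le> \<rho> \<longrightarrow> (\<exists>x\<in>S. dist x b \<le> R + 6 * real m)))"
    proof (intro exI[of _ "fill a"] ballI conjI impI)
      fix S assume S: "S \<in> rips V"
      show "ext set_bd (fill a S) + ext (fill a) (set_bd S) = snap S"
        by (rule fill_boundary[OF a(1) S])
      fix S' assume S': "S' \<in> keys (fill a S)"
      show "S' \<in> rips V" "card S' = Suc (card S)"
        using fill_keys(1)[OF a(1) S S'] by simp_all
      fix y assume "y \<in> S'" "dist y b \<le> \<rho>"
      then show "\<exists>x\<in>S. dist x b \<le> R + 6 * real m" by (rule close[OF S S'])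
    qed
  qed
qed

end

section \<open>Geodesic contraction in CAT(0) spaces\<close>

definition radial_geodesic :: "'a::metric_space set \<Rightarrow> 'a \<Rightarrow> 'a \<Rightarrow> (real \<Rightarrow> 'a) \<Rightarrow> bool" where
  "radial_geodesic X a x \<gamma> \<longleftrightarrow> \<gamma> 0 = a \<and> \<gamma> (dist a x) = x \<and> \<gamma> ` {0..dist a x} \<subseteq> X \<and>
     (\<forall>s\<in>{0..dist a x}. \<forall>t\<in>{0..dist a x}. dist (\<gamma> s) (\<gamma> t) = \<bar>s - t\<bar>)"

lemma radial_geodesic_exists:
  assumes "geodesic_space X" "a \<in> X" "x \<in> X"
  shows "\<exists>\<gamma>. radial_geodesic X a x \<gamma>"
proof -
  obtain S where "geodesic_segment X S a x"
    using assms unfolding geodesic_space_def by blast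
  then obtain \<gamma> l where l: "0 \<le> l" "\<gamma> ` {0..l} = S" "S \<subseteq> X" "\<gamma> 0 = a" "\<gamma> l = x"
    "\<forall>s\<in>{0..l}. \<forall>t\<in>{0..l}. dist (\<gamma> s) (\<gamma> t) = \<bar>s - t\<bar>"
    unfolding geodesic_segment_def by blast
  then have "dist (\<gamma> 0) (\<gamma> l) = \<bar>0 - l\<bar>" by (metis atLeastAtMost_iff order_refl)
  then have "dist a x = l" using l by simp
  then show ?thesis using l unfolding radial_geodesic_def by blast
qed

text \<open>The nearest point projection to the ball of radius \<open>s\<close> about \<open>a\<close>, along a chosen geodesic from \<open>a\<close>
  to \<open>x\<close>.\<close>

definition contract :: "'a::metric_space set \<Rightarrow> 'a \<Rightarrow> real \<Rightarrow> 'a \<Rightarrow> 'a" where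
  "contract X a s x = (SOME \<gamma>. radial_geodesic X a x \<gamma>) (min s (dist a x))"

lemma contract_eq:
  assumes "geodesic_space X" "a \<in> X" "x \<in> X"
  obtains \<gamma> where "radial_geodesic X a x \<gamma>" "\<And>s. contract X a s x = \<gamma> (min s (dist a x))"
  using someI_ex[OF radial_geodesic_exists[OF assms]] that unfolding contract_def by blast

lemma contract_props:
  assumes "geodesic_space X" "a \<in> X" "x \<in> X" "0 \<le> s" "0 \<le> t"
  shows "contract X a s x \<in> X"
    and "contract X a 0 x = a"
    and "dist a x \<le> s \<Longrightarrow> contract X a s x = x"
    and "dist a (contract X a s x) = min s (dist a x)"
    and "dist (contract X a s x) x = dist a x - min s (dist a x)"
    and "dist (contract X a s x) (contract X a t x) \<le> \<bar>s - t\<bar>"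
proof -
  obtain \<gamma> where \<gamma>: "radial_geodesic X a x \<gamma>" and c: "\<And>s. contract X a s x = \<gamma> (min s (dist a x))"
    using contract_eq[OF assms(1-3)] by blast
  have iso: "dist (\<gamma> u) (\<gamma> v) = \<bar>u - v\<bar>" if "0 \<le> u" "u \<le> dist a x" "0 \<le> v" "v \<le> dist a x" for u v
    using \<gamma> that unfolding radial_geodesic_def by simp
  have ends: "\<gamma> 0 = a" "\<gamma> (dist a x) = x" using \<gamma> by (simp_all add: radial_geodesic_def)
  have "min s (dist a x) \<in> {0..dist a x}" using assms by simp
  then show "contract X a s x \<in> X" using \<gamma> unfolding c radial_geodesic_def by blast
  show "contract X a 0 x = a" by (simp add: c ends)
  show "contract X a s x = x" if "dist a x \<le> s" using that by (simp add: c ends min_absorb2)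
  show "dist a (contract X a s x) = min s (dist a x)"
    using iso[of 0 "min s (dist a x)"] assms(4) by (simp add: c ends)
  show "dist (contract X a s x) x = dist a x - min s (dist a x)"
    using iso[of "min s (dist a x)" "dist a x"] assms(4) by (simp add: c ends)
  show "dist (contract X a s x) (contract X a t x) \<le> \<bar>s - t\<bar>"
    using iso[of "min s (dist a x)" "min t (dist a x)"] assms(4,5) by (simp add: c)
qed

lemma geodesic_segment_contract:
  assumes "geodesic_space X" "a \<in> X" "x \<in> X"
  shows "\<exists>S. geodesic_segment X S a x \<and> (\<forall>s\<ge>0. contract X a s x \<in> S)"
proof -
  obtain \<gamma> where \<gamma>: "radial_geodesic X a x \<gamma>" and c: "\<And>s. contract X a s x = \<gamma> (min s (dist a x))"
    using contract_eq[OF assms] by blast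
  have "geodesic_segment X (\<gamma> ` {0..dist a x}) a x"
    unfolding geodesic_segment_def
    by (rule exI[of _ \<gamma>], rule exI[of _ "dist a x"]) (use \<gamma> in \<open>simp add: radial_geodesic_def\<close>)
  then show ?thesis using c by fastforce
qed

lemma geodesic_segment_reverse:
  assumes "geodesic_segment X S p q"
  shows "geodesic_segment X S q p"
proof -
  obtain \<gamma> l where l: "0 \<le> l" "\<gamma> ` {0..l} = S" "S \<subseteq> X" "\<gamma> 0 = p" "\<gamma> l = q"
    "\<forall>s\<in>{0..l}. \<forall>t\<in>{0..l}. dist (\<gamma> s) (\<gamma> t) = \<bar>s - t\<bar>"
    using assms unfolding geodesic_segment_def by blast
  have "(\<lambda>t. \<gamma> (l - t)) ` {0..l} = \<gamma> ` ((\<lambda>t. l - t) ` {0..l})" by (simp only: image_image)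
  also have "(\<lambda>t. l - t) ` {0..l} = {0..l}" by simp
  finally have "(\<lambda>t. \<gamma> (l - t)) ` {0..l} = S" by (simp only: l(2))
  then show ?thesis
    unfolding geodesic_segment_def using l
    by (intro exI[of _ "\<lambda>t. \<gamma> (l - t)"] exI[of _ l]) auto
qed

lemma dist_vector_2:
  "dist (vector [x, y] :: real^2) (vector [x', y']) = sqrt ((x - x')\<^sup>2 + (y - y')\<^sup>2)"
  by (simp add: dist_vec_def L2_set_def sum_2 dist_real_def)

text \<open>Put one side on the first axis and solve for the third vertex by the law of cosines.\<close>

lemma comparison_triangle_exists:
  fixes a b c :: real
  assumes "0 \<le> a" "0 \<le> b" "0 \<le> c" "a \<le> b + c" "b \<le> a + c" "c \<le> a + b"
  shows "\<exists>p q r :: real^2. dist p q = c \<and> dist q r = a \<and> dist r p = b"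
proof (cases "c = 0")
  case True
  then have "a = b" using assms by simp
  then show ?thesis
    using True assms
    by (intro exI[of _ "vector [0, 0] :: real^2"] exI[of _ "vector [b, 0] :: real^2"]) (simp add: dist_vector_2)
next
  case False
  then have c: "0 < c" using assms by simp
  define u where "u = (b\<^sup>2 + c\<^sup>2 - a\<^sup>2) / (2 * c)"
  have u: "2 * c * u = b\<^sup>2 + c\<^sup>2 - a\<^sup>2" using c by (simp add: u_def)
  have "(b + c)\<^sup>2 \<ge> a\<^sup>2" using assms by (intro power_mono) auto
  then have "2 * c * (- b) \<le> 2 * c * u" unfolding u by (simp add: power2_sum algebra_simps)
  then have u1: "- b \<le> u" by (rule mult_left_le_imp_le) (use c in simp)
  have "\<bar>b - c\<bar> \<le> \<bar>a\<bar>" using assms by auto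
  then have "(b - c)\<^sup>2 \<le> a\<^sup>2" by (simp add: abs_le_square_iff)
  then have "2 * c * u \<le> 2 * c * b" unfolding u by (simp add: power2_diff algebra_simps)
  then have u2: "u \<le> b" by (rule mult_left_le_imp_le) (use c in simp)
  have "\<bar>u\<bar> \<le> \<bar>b\<bar>" using u1 u2 by simp
  then have "u\<^sup>2 \<le> b\<^sup>2" by (simp add: abs_le_square_iff)
  then have v: "(sqrt (b\<^sup>2 - u\<^sup>2))\<^sup>2 = b\<^sup>2 - u\<^sup>2" by simp
  let ?v = "sqrt (b\<^sup>2 - u\<^sup>2)"
  have "dist (vector [0, 0] :: real^2) (vector [c, 0]) = c" using c by (simp add: dist_vector_2)
  moreover have "dist (vector [c, 0] :: real^2) (vector [u, ?v]) = a"
  proof -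
    have "(c - u)\<^sup>2 + (0 - ?v)\<^sup>2 = a\<^sup>2" using u v by (simp add: power2_diff)
    then show ?thesis using assms by (simp add: dist_vector_2)
  qed
  moreover have "dist (vector [u, ?v] :: real^2) (vector [0, 0]) = b"
    using v assms by (simp add: dist_vector_2)
  ultimately show ?thesis by blast
qed

text \<open>The comparison point at distance \<open>s\<close> from \<open>p\<close> is the metric projection of \<open>q\<close> to the
  disc of radius \<open>s\<close> about \<open>p\<close>; in this way the Lipschitz property of projections to convex sets
  becomes available.\<close>

lemma segment_point:
  fixes p q :: "real^2"
  assumes "0 \<le> s"
  obtains z where "z \<in> closed_segment p q" "dist p z = min s (dist p q)"
    "dist q z = dist p q - min s (dist p q)"
    "z = closest_point (cball p s) q"
proof -
  define u where "u = min s (dist p q) / dist p q"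
  define z where "z = (1 - u) *\<^sub>R p + u *\<^sub>R q"
  have u: "0 \<le> u" "u \<le> 1" using assms by (auto simp: u_def divide_le_eq_1)
  have ud: "u * dist p q = min s (dist p q)" using assms by (simp add: u_def)
  have "z \<in> closed_segment p q" using u by (auto simp: z_def closed_segment_def)
  moreover have "p - z = u *\<^sub>R (p - q)" "q - z = (1 - u) *\<^sub>R (q - p)"
    by (simp_all add: z_def algebra_simps)
  then have pz: "dist p z = u * dist p q" "dist q z = (1 - u) * dist p q"
    using u by (simp_all add: dist_norm norm_minus_commute)
  moreover have qz: "dist q z = dist p q - min s (dist p q)" using pz ud by (simp add: algebra_simps)
  moreover have "z = closest_point (cball p s) q"
  proof (rule closest_point_unique)
    show "\<forall>w\<in>cball p s. dist q z \<le> dist q w"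
    proof
      fix w assume "w \<in> cball p s"
      then show "dist q z \<le> dist q w"
        using qz dist_triangle[of p q w] by (auto simp: dist_commute min_def)
    qed
  qed (use pz ud in auto)
  ultimately show ?thesis using that ud by simp
qed

text \<open>In the comparison triangle the two points are projections of the far vertices to a disc
  about the common vertex, and such a projection does not increase distances.\<close>

lemma contract_lipschitz:
  assumes "CAT0_space X" "a \<in> X" "x \<in> X" "y \<in> X" "0 \<le> s"
  shows "dist (contract X a s x) (contract X a s y) \<le> dist x y"
proof -
  have geo: "geodesic_space X" using assms by (simp add: CAT0_space_def)
  obtain A where A: "geodesic_segment X A a x" "contract X a s x \<in> A"
    using geodesic_segment_contract[OF geo assms(2,3)] assms(5) by blast
  obtain C where C: "geodesic_segment X C a y" "contract X a s y \<in> C"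
    using geodesic_segment_contract[OF geo assms(2,4)] assms(5) by blast
  obtain B where B: "geodesic_segment X B x y"
    using geo assms(3,4) unfolding geodesic_space_def by blast
  have T: "CAT0_triangle a x y A B C"
    using assms A(1) B geodesic_segment_reverse[OF C(1)] unfolding CAT0_space_def by blast
  obtain p q r :: "real^2" where pqr: "dist p q = dist a x" "dist q r = dist x y" "dist r p = dist y a"
    using comparison_triangle_exists[of "dist x y" "dist y a" "dist a x"]
      dist_triangle[of x y a] dist_triangle[of y a x] dist_triangle[of a x y]
    by (auto simp: dist_commute)
  obtain z where z: "z \<in> closed_segment p q" "dist p z = min s (dist p q)" "z = closest_point (cball p s) q"
    using segment_point[OF assms(5)] by blast
  obtain w where w: "w \<in> closed_segment p r" "dist r w = dist p r - min s (dist p r)"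
    "w = closest_point (cball p s) r"
    using segment_point[OF assms(5)] by blast
  have "comparison_point A a x p q (contract X a s x) z"
    unfolding comparison_point_def
    using A z pqr contract_props(4)[OF geo assms(2,3,5,5)] by simp
  moreover have "comparison_point C y a r p (contract X a s y) w"
    unfolding comparison_point_def
    using C w pqr contract_props(5)[OF geo assms(2,4,5,5)]
    by (simp add: dist_commute closed_segment_commute)
  ultimately have "dist (contract X a s x) (contract X a s y) \<le> dist z w"
    using T pqr unfolding CAT0_triangle_def Let_def by blast
  also have "\<dots> \<le> dist q r"
    unfolding z(3) w(3) by (rule closest_point_lipschitz) (use assms(5) in auto)
  finally show ?thesis using pqr by simp
qed

section \<open>Rays as limits of long geodesics\<close>

lemma broken_geodesic:
  assumes "geodesic_space X" "a \<in> X" "x \<in> X" "y \<in> X" "dist a y + dist y x = dist a x"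
  shows "\<exists>\<gamma>. radial_geodesic X a x \<gamma> \<and> \<gamma> (dist a y) = y"
proof -
  obtain \<alpha> where \<alpha>: "radial_geodesic X a y \<alpha>" using radial_geodesic_exists assms by blast
  obtain \<beta> where \<beta>: "radial_geodesic X y x \<beta>" using radial_geodesic_exists assms by blast
  define \<gamma> where "\<gamma> t = (if t \<le> dist a y then \<alpha> t else \<beta> (t - dist a y))" for t
  have \<alpha>_iso: "dist (\<alpha> s) (\<alpha> t) = \<bar>s - t\<bar>" if "0 \<le> s" "s \<le> dist a y" "0 \<le> t" "t \<le> dist a y" for s t
    using \<alpha> that unfolding radial_geodesic_def by simp
  have \<beta>_iso: "dist (\<beta> s) (\<beta> t) = \<bar>s - t\<bar>" if "0 \<le> s" "s \<le> dist y x" "0 \<le> t" "t \<le> dist y x" for s t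
    using \<beta> that unfolding radial_geodesic_def by simp
  have e: "\<alpha> 0 = a" "\<alpha> (dist a y) = y" "\<beta> 0 = y" "\<beta> (dist y x) = x"
    using \<alpha> \<beta> by (simp_all add: radial_geodesic_def)
  have \<gamma>y: "\<gamma> (dist a y) = y" and \<gamma>0: "\<gamma> 0 = a" by (simp_all add: \<gamma>_def e)
  have \<gamma>x: "\<gamma> (dist a x) = x"
  proof (cases "dist y x = 0")
    case True
    then show ?thesis using assms(5) e by (simp add: \<gamma>_def)
  next
    case False
    then have "\<not> dist a x \<le> dist a y" using assms(5) zero_le_dist[of y x] by linarith
    moreover have "dist a x - dist a y = dist y x" using assms(5) by linarith
    ultimately show ?thesis using e by (simp add: \<gamma>_def)
  qed
  have le: "dist (\<gamma> s) (\<gamma> t) = t - s" if st: "0 \<le> s" "s \<le> t" "t \<le> dist a x" for s t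
  proof -
    consider "t \<le> dist a y" | "dist a y < s" | "s \<le> dist a y" "dist a y < t" by linarith
    then show ?thesis
    proof cases
      case 1 then show ?thesis using \<alpha>_iso[of s t] st by (simp add: \<gamma>_def)
    next
      case 2 then show ?thesis
        using \<beta>_iso[of "s - dist a y" "t - dist a y"] st assms(5) by (simp add: \<gamma>_def)
    next
      case 3
      then have d: "dist a (\<gamma> s) = s" "dist (\<gamma> s) y = dist a y - s"
          "dist y (\<gamma> t) = t - dist a y" "dist (\<gamma> t) x = dist a x - t"
        using \<alpha>_iso[of 0 s] \<alpha>_iso[of s "dist a y"] \<beta>_iso[of 0 "t - dist a y"]
          \<beta>_iso[of "t - dist a y" "dist y x"] e st assms(5) by (simp_all add: \<gamma>_def)
      then show ?thesis
        using dist_triangle[of "\<gamma> s" "\<gamma> t" y] dist_triangle[of a x "\<gamma> s"]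
          dist_triangle[of "\<gamma> s" x "\<gamma> t"] by linarith
    qed
  qed
  have "dist (\<gamma> s) (\<gamma> t) = \<bar>s - t\<bar>" if "s \<in> {0..dist a x}" "t \<in> {0..dist a x}" for s t
    using le[of s t] le[of t s] that by (cases "s \<le> t") (auto simp: dist_commute)
  moreover have "\<gamma> t \<in> X" if t: "t \<in> {0..dist a x}" for t
  proof (cases "t \<le> dist a y")
    case True
    then have "\<alpha> t \<in> \<alpha> ` {0..dist a y}" using t by simp
    then show ?thesis using True \<alpha> unfolding \<gamma>_def radial_geodesic_def by auto
  next
    case False
    then have "\<beta> (t - dist a y) \<in> \<beta> ` {0..dist y x}" using t assms(5) by simp
    then show ?thesis using False \<beta> unfolding \<gamma>_def radial_geodesic_def by auto
  qed
  ultimately show ?thesis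
    using \<gamma>0 \<gamma>x \<gamma>y unfolding radial_geodesic_def by blast
qed

lemma compact_PiE_fun:
  fixes S :: "'i \<Rightarrow> 'b::topological_space set"
  assumes "\<And>i. compact (S i)"
  shows "compact {f. \<forall>i. f i \<in> S i}"
proof -
  have "{f. \<forall>i. f i \<in> S i} = Pi\<^sub>E UNIV S" by (auto simp: PiE_iff)
  moreover have "compactin (product_topology (\<lambda>_. euclidean) UNIV) (Pi\<^sub>E UNIV S)"
    using assms by (simp add: compactin_PiE)
  ultimately show ?thesis by (simp add: euclidean_product_topology flip: compactin_euclidean_iff)
qed

text \<open>Compactness of the product of the balls of radius \<open>t\<close> about \<open>a\<close>, one for each time \<open>t\<close>. Being
  isometric up to time \<open>n\<close> is a closed condition on \<open>f\<close>. Passing near \<open>b\<close> at some time is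
  turned into a finite union of closed conditions by restricting to integral times, at the
  price of the additional \<open>1\<close>.\<close>

lemma ray_from_long_geodesics:
  assumes geo: "geodesic_space X" and proper: "proper_space X" and a: "a \<in> X"
    and long: "\<And>n::nat. \<exists>x\<in>X. \<exists>y\<in>X. real n < dist x b \<and> dist a y + dist y x = dist a x \<and> dist y b \<le> \<rho>"
  shows "\<exists>\<gamma>. geodesic_ray X \<gamma> \<and> \<gamma> 0 = a \<and> (\<exists>t\<ge>0. dist (\<gamma> t) b \<le> \<rho> + 1)"
proof -
  define P where "P = {f :: real \<Rightarrow> 'a. \<forall>t. f t \<in> X \<inter> cball a (max t 0)}"
  define m where "m = nat \<lceil>dist a b + \<rho>\<rceil>"
  define K where "K n = {f :: real \<Rightarrow> 'a. \<forall>s\<in>{0..real n}. \<forall>t\<in>{0..real n}. dist (f s) (f t) = \<bar>s - t\<bar>}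
      \<inter> (\<Union>i\<in>{..m}. {f. dist (f (real i)) b \<le> \<rho> + 1})" for n :: nat
  have compact: "compact P"
    unfolding P_def by (rule compact_PiE_fun) (use proper a in \<open>simp add: proper_space_def\<close>)
  have closed: "closed (K n)" for n
  proof -
    have "closed {f :: real \<Rightarrow> 'a. dist (f s) (f t) = \<bar>s - t\<bar>}" for s t
      by (intro closed_Collect_eq continuous_intros) auto
    moreover have "closed {f :: real \<Rightarrow> 'a. dist (f s) b \<le> \<rho> + 1}" for s
      by (intro closed_Collect_le continuous_intros) auto
    ultimately show ?thesis
      unfolding K_def Ball_def by (intro closed_Int closed_UN closed_Collect_all closed_Collect_imp) auto
  qed
  have fip: "P \<inter> (\<Inter>n\<in>I. K n) \<noteq> {}" if fin: "finite I" for I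
  proof -
    obtain N where N: "\<And>n. n \<in> I \<Longrightarrow> n \<le> N" using fin unfolding finite_nat_set_iff_bounded_le by blast
    obtain x y where x: "x \<in> X" and y: "y \<in> X" and xb: "real (N + nat \<lceil>dist a b\<rceil>) < dist x b"
      and bet: "dist a y + dist y x = dist a x" and yb: "dist y b \<le> \<rho>"
      using long by blast
    obtain \<gamma> where \<gamma>: "radial_geodesic X a x \<gamma>" "\<gamma> (dist a y) = y"
      using broken_geodesic[OF geo a x y bet] by blast
    have iso: "dist (\<gamma> u) (\<gamma> v) = \<bar>u - v\<bar>" if "0 \<le> u" "u \<le> dist a x" "0 \<le> v" "v \<le> dist a x" for u v
      using \<gamma> that unfolding radial_geodesic_def by simp
    define f where "f t = \<gamma> (min (max t 0) (dist a x))" for t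
    have Nx: "real N \<le> dist a x"
      using xb real_nat_ceiling_ge[of "dist a b"] dist_triangle[of x b a]
      unfolding of_nat_add dist_commute[of x a] by linarith
    have "f \<in> P"
    proof -
      have "f t \<in> X" for t
        using \<gamma>(1) unfolding f_def radial_geodesic_def by auto
      moreover have "dist a (f t) \<le> max t 0" for t
        using iso[of 0 "min (max t 0) (dist a x)"] \<gamma>(1) by (simp add: f_def radial_geodesic_def)
      ultimately show ?thesis by (simp add: P_def)
    qed
    moreover have "f \<in> K n" if "n \<in> I" for n
    proof -
      have "real n \<le> dist a x" using N[OF that] Nx by linarith
      then have "dist (f s) (f t) = \<bar>s - t\<bar>" if "s \<in> {0..real n}" "t \<in> {0..real n}" for s t
        using iso[of s t] that by (simp add: f_def)
      moreover have "f \<in> (\<Union>i\<in>{..m}. {f. dist (f (real i)) b \<le> \<rho> + 1})"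
      proof -
        define i where "i = nat \<lfloor>dist a y\<rfloor>"
        have i: "real i \<le> dist a y" "dist a y \<le> real i + 1"
          unfolding i_def using zero_le_dist[of a y] by linarith+
        have "dist a y \<le> dist a b + \<rho>" using yb dist_triangle[of a y b] by (simp add: dist_commute)
        then have "real i \<le> real m"
          using i(1) real_nat_ceiling_ge[of "dist a b + \<rho>"] unfolding m_def by linarith
        then have "i \<in> {..m}" by simp
        moreover have yx: "dist a y \<le> dist a x" using bet zero_le_dist[of y x] by linarith
        then have "f (real i) = \<gamma> (real i)" using i by (simp add: f_def)
        then have "dist (f (real i)) y \<le> 1"
          using iso[of "real i" "dist a y"] \<gamma>(2) i yx by simp
        then have "dist (f (real i)) b \<le> \<rho> + 1"
          using yb dist_triangle[of "f (real i)" b y] by simp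
        ultimately show ?thesis by blast
      qed
      ultimately show ?thesis by (simp add: K_def)
    qed
    ultimately show ?thesis by blast
  qed
  have "P \<inter> (\<Inter>n\<in>UNIV. K n) \<noteq> {}"
    by (rule compact_imp_fip_image[OF compact]) (rule closed, rule fip)
  then obtain f where fP: "f \<in> P" and fK: "\<And>n. f \<in> K n" by blast
  have "dist (f s) (f t) = \<bar>s - t\<bar>" if "0 \<le> s" "0 \<le> t" for s t
  proof -
    obtain n :: nat where "max s t \<le> real n" using real_arch_simple by blast
    then show ?thesis using fK[of n] that unfolding K_def by auto
  qed
  moreover have "f 0 = a" using fP by (auto simp: P_def dest: spec[of _ 0])
  moreover obtain i :: nat where "dist (f (real i)) b \<le> \<rho> + 1" using fK[of 0] unfolding K_def by blast
  then have "\<exists>t\<ge>0. dist (f t) b \<le> \<rho> + 1" by (intro exI[of _ "real i"]) simp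
  ultimately show ?thesis
    using fP by (intro exI[of _ f]) (auto simp: geodesic_ray_def P_def)
qed

section \<open>Cocompactness and uniform constants\<close>

text \<open>If \<open>b = h c\<close> and \<open>b' = h' c'\<close> with \<open>c\<close> and \<open>c'\<close> in the compact set, then \<open>h' h\<inverse>\<close> moves \<open>b\<close> to
  \<open>h' c\<close>, which is as close to \<open>b'\<close> as \<open>c\<close> is to \<open>c'\<close>.\<close>

lemma cocompact_quasi_transitive:
  assumes "cocompact_space X"
  obtains \<Delta> where "\<And>b b'. b \<in> X \<Longrightarrow> b' \<in> X \<Longrightarrow> \<exists>g\<in>self_isometries X. dist (g b) b' \<le> \<Delta>"
proof -
  obtain C where C: "C \<subseteq> X" "compact C" "X \<subseteq> (\<Union>h\<in>self_isometries X. h ` C)"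
    using assms unfolding cocompact_space_def by blast
  obtain \<Delta> where \<Delta>: "\<And>x y. x \<in> C \<Longrightarrow> y \<in> C \<Longrightarrow> dist x y \<le> \<Delta>"
    using compact_imp_bounded[OF C(2)] unfolding bounded_two_points by blast
  have "\<exists>g\<in>self_isometries X. dist (g b) b' \<le> \<Delta>" if b: "b \<in> X" "b' \<in> X" for b b'
  proof -
    obtain h c where h: "h \<in> self_isometries X" "c \<in> C" "b = h c" using C(3) b(1) by blast
    obtain h' c' where h': "h' \<in> self_isometries X" "c' \<in> C" "b' = h' c'" using C(3) b(2) by blast
    have im: "h ` X = X" "h' ` X = X"
      and iso: "\<And>x y. x \<in> X \<Longrightarrow> y \<in> X \<Longrightarrow> dist (h x) (h y) = dist x y"
        "\<And>x y. x \<in> X \<Longrightarrow> y \<in> X \<Longrightarrow> dist (h' x) (h' y) = dist x y"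
      using h(1) h'(1) by (auto simp: self_isometries_def)
    have inj: "inj_on h X" by (rule inj_onI) (metis iso(1) dist_eq_0_iff)
    define k where "k = inv_into X h"
    have k: "k x \<in> X" "h (k x) = x" if "x \<in> X" for x
      unfolding k_def using that im(1) by (metis inv_into_into, metis f_inv_into_f)
    have kh: "k (h x) = x" if "x \<in> X" for x
      unfolding k_def by (rule inv_into_f_f[OF inj that])
    have "k ` X = X" using k(1) kh im(1) by (metis image_subset_iff image_eqI subsetI subset_antisym)
    then have "(h' \<circ> k) ` X = X" using im(2) by (simp flip: image_image add: image_comp[symmetric])
    moreover have "dist (h' (k x)) (h' (k y)) = dist x y" if "x \<in> X" "y \<in> X" for x y
      using iso(1)[of "k x" "k y"] iso(2)[of "k x" "k y"] k that by simp
    ultimately have "h' \<circ> k \<in> self_isometries X" by (simp add: self_isometries_def)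
    moreover have "dist ((h' \<circ> k) b) b' \<le> \<Delta>"
    proof -
      have "c \<in> X" "c' \<in> X" using h h' C(1) by auto
      then show ?thesis using \<Delta>[OF h(2) h'(2)] iso(2)[of c c'] kh[of c] h(3) h'(3) by simp
    qed
    ultimately show ?thesis by blast
  qed
  then show ?thesis using that by blast
qed

lemma separated_net_exists:
  fixes X :: "'a::metric_space set"
  obtains V where "V \<subseteq> X" "\<And>u v. u \<in> V \<Longrightarrow> v \<in> V \<Longrightarrow> u \<noteq> v \<Longrightarrow> 1 \<le> dist u v"
    "\<And>x. x \<in> X \<Longrightarrow> \<exists>v\<in>V. dist x v \<le> 1"
proof -
  define \<A> where "\<A> = {V. V \<subseteq> X \<and> (\<forall>u\<in>V. \<forall>v\<in>V. u \<noteq> v \<longrightarrow> 1 \<le> dist u v)}"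
  have "\<exists>M\<in>\<A>. \<forall>V\<in>\<A>. M \<subseteq> V \<longrightarrow> V = M"
  proof (rule subset_Zorn')
    fix \<C> assume chain: "subset.chain \<A> \<C>"
    have "1 \<le> dist u v" if uv: "u \<in> \<Union>\<C>" "v \<in> \<Union>\<C>" "u \<noteq> v" for u v
    proof -
      obtain U W where UW: "u \<in> U" "U \<in> \<C>" "v \<in> W" "W \<in> \<C>" using uv by blast
      then have "U \<subseteq> W \<or> W \<subseteq> U" using chain unfolding subset_chain_def by blast
      then have "\<exists>Z\<in>\<C>. u \<in> Z \<and> v \<in> Z" using UW by blast
      then show ?thesis using chain uv(3) unfolding subset_chain_def \<A>_def by blast
    qed
    then show "\<Union>\<C> \<in> \<A>" using chain unfolding subset_chain_def \<A>_def by blast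
  qed
  then obtain V where V: "V \<in> \<A>" and max: "\<And>W. W \<in> \<A> \<Longrightarrow> V \<subseteq> W \<Longrightarrow> W = V" by blast
  have "\<exists>v\<in>V. dist x v \<le> 1" if x: "x \<in> X" for x
  proof (rule ccontr)
    assume far: "\<not> (\<exists>v\<in>V. dist x v \<le> 1)"
    then have "insert x V \<in> \<A>" using V x unfolding \<A>_def by (force simp: dist_commute)
    then have "x \<in> V" using max by blast
    then show False using far by force
  qed
  moreover have "V \<subseteq> X" "\<And>u v. u \<in> V \<Longrightarrow> v \<in> V \<Longrightarrow> u \<noteq> v \<Longrightarrow> 1 \<le> dist u v"
    using V unfolding \<A>_def by blast+
  ultimately show ?thesis by (rule that[rotated 2])
qed

text \<open>Moved close to a fixed point, the ball lies in one fixed compact set, which is covered by finitely many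
  balls of radius \<open>1/2\<close>; each of these contains at most one point of a \<open>1\<close>-separated set.\<close>

lemma separated_uniformly_finite:
  assumes proper: "proper_space X" and cocompact: "cocompact_space X" and "V \<subseteq> X"
    and sep: "\<And>u v. u \<in> V \<Longrightarrow> v \<in> V \<Longrightarrow> u \<noteq> v \<Longrightarrow> 1 \<le> dist u v"
  shows "\<exists>M. \<forall>b\<in>X. finite (V \<inter> cball b r) \<and> card (V \<inter> cball b r) \<le> M"
proof (cases "X = {}")
  case False
  then obtain p where p: "p \<in> X" by blast
  obtain \<Delta> where \<Delta>: "\<And>b b'. b \<in> X \<Longrightarrow> b' \<in> X \<Longrightarrow> \<exists>g\<in>self_isometries X. dist (g b) b' \<le> \<Delta>"
    using cocompact_quasi_transitive[OF cocompact] by blast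
  let ?B = "X \<inter> cball p (\<Delta> + r)"
  have compact: "compact ?B" using proper p unfolding proper_space_def by blast
  have "?B \<subseteq> (\<Union>z\<in>?B. ball z (1/2))" by force
  from compactE_image[OF compact _ this]
  obtain F where F: "finite F" "?B \<subseteq> (\<Union>z\<in>F. ball z (1/2))" by (metis open_ball)
  have bound: "card A \<le> card F" if b: "b \<in> X" and A: "A \<subseteq> V \<inter> cball b r" for b A
  proof -
    obtain g where g: "g \<in> self_isometries X" "dist (g b) p \<le> \<Delta>" using \<Delta>[OF b p] by blast
    have gX: "g x \<in> X" if "x \<in> X" for x using g(1) that unfolding self_isometries_def by blast
    have iso: "dist (g x) (g y) = dist x y" if "x \<in> X" "y \<in> X" for x y
      using g(1) that by (simp add: self_isometries_def)
    have AX: "A \<subseteq> X" using A \<open>V \<subseteq> X\<close> by blast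
    have "\<exists>z\<in>F. dist z (g v) < 1/2" if v: "v \<in> A" for v
    proof -
      have "v \<in> X" "v \<in> cball b r" using v A AX by blast+
      then have "dist (g b) (g v) \<le> r" using iso[OF b, of v] by simp
      then have "g v \<in> X \<inter> cball p (\<Delta> + r)"
        using g(2) gX v AX dist_triangle[of p "g v" "g b"] by (auto simp: dist_commute)
      then obtain z where "z \<in> F" "g v \<in> ball z (1/2)" using F(2) by blast
      then show ?thesis unfolding mem_ball by blast
    qed
    then obtain c where c: "\<And>v. v \<in> A \<Longrightarrow> c v \<in> F \<and> dist (c v) (g v) < 1/2" by metis
    have "inj_on c A"
    proof (rule inj_onI, rule ccontr)
      fix u v assume uv: "u \<in> A" "v \<in> A" "c u = c v" "u \<noteq> v"
      have "dist (g u) (g v) < 1"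
        using c[OF uv(1)] c[OF uv(2)] uv(3) dist_triangle[of "g u" "g v" "c u"] by (simp add: dist_commute)
      moreover have "dist (g u) (g v) = dist u v" using iso uv AX by blast
      ultimately show False using sep[of u v] uv A by force
    qed
    then show ?thesis using c F(1) by (intro card_inj_on_le) auto
  qed
  have "finite (V \<inter> cball b r)" if "b \<in> X" for b
    using finite_if_finite_subsets_card_bdd[of "V \<inter> cball b r" "card F"] bound[OF that] by blast
  then show ?thesis using bound by blast
qed simp

lemma unbounded_of_noncompact:
  assumes "proper_space X" "\<not> compact X" "b \<in> X"
  shows "\<exists>x\<in>X. R < dist x b"
proof (rule ccontr)
  assume "\<not> (\<exists>x\<in>X. R < dist x b)"
  then have "X \<inter> cball b R = X" by (force simp: dist_commute)
  then show False using assms unfolding proper_space_def by metis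
qed

text \<open>Failure of almost geodesic completeness for a slightly larger radius gives one pair \<open>a\<close>, \<open>b\<close> with
  bounded shadow, because \<open>ray_from_long_geodesics\<close> excludes long geodesics. That \<open>a\<close> itself is far
  from \<open>b\<close> is the case \<open>y = a\<close>, for which a distant point \<open>x\<close> is required: here \<open>X\<close> has to be
  non-compact. Isometries transport the pair to all other points.\<close>

lemma bounded_shadows:
  assumes geo: "geodesic_space X" and proper: "proper_space X" and cocompact: "cocompact_space X"
    and noncompact: "\<not> compact X" and "\<not> almost_geodesically_complete X"
  shows "\<exists>R. \<forall>b\<in>X. \<exists>a\<in>X. \<rho> < dist a b \<and>
       (\<forall>x\<in>X. R < dist x b \<longrightarrow> (\<forall>y\<in>X. dist a y + dist y x = dist a x \<longrightarrow> \<rho> < dist y b))"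
proof -
  obtain \<Delta> where \<Delta>: "\<And>b b'. b \<in> X \<Longrightarrow> b' \<in> X \<Longrightarrow> \<exists>g\<in>self_isometries X. dist (g b) b' \<le> \<Delta>"
    using cocompact_quasi_transitive[OF cocompact] by blast
  define r where "r = max (\<rho> + \<Delta> + 2) 0"
  obtain a b where a: "a \<in> X" and b: "b \<in> X"
    and no_ray: "\<And>\<gamma>. geodesic_ray X \<gamma> \<Longrightarrow> \<gamma> 0 = a \<Longrightarrow> \<gamma> ` {0..} \<inter> ball b r = {}"
    using assms(5) unfolding almost_geodesically_complete_def r_def by (meson max.cobounded2)
  have "\<not> (\<exists>\<gamma>. geodesic_ray X \<gamma> \<and> \<gamma> 0 = a \<and> (\<exists>t\<ge>0. dist (\<gamma> t) b \<le> \<rho> + \<Delta> + 1))"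
    using no_ray unfolding r_def by (fastforce simp: dist_commute)
  then obtain n :: nat where n: "\<And>x y. x \<in> X \<Longrightarrow> y \<in> X \<Longrightarrow> real n < dist x b \<Longrightarrow>
      dist a y + dist y x = dist a x \<Longrightarrow> \<rho> + \<Delta> < dist y b"
    using ray_from_long_geodesics[OF geo proper a, of b "\<rho> + \<Delta>"] by (meson not_le)
  have far: "\<rho> + \<Delta> < dist a b"
    using n[OF _ a] unbounded_of_noncompact[OF proper noncompact b, of "real n"] by force
  show ?thesis
  proof (intro exI[of _ "real n + \<Delta>"] ballI)
    fix b' assume b': "b' \<in> X"
    obtain g where g: "g \<in> self_isometries X" "dist (g b) b' \<le> \<Delta>" using \<Delta>[OF b b'] by blast
    have gX: "g ` X = X" and iso: "\<And>x y. x \<in> X \<Longrightarrow> y \<in> X \<Longrightarrow> dist (g x) (g y) = dist x y"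
      using g(1) by (auto simp: self_isometries_def)
    have "\<rho> < dist (g a) b'"
      using far iso[OF a b] g(2) dist_triangle[of "g a" "g b" b'] dist_commute[of b' "g b"] by linarith
    moreover have "\<rho> < dist y b'"
      if xy: "x \<in> X" "real n + \<Delta> < dist x b'" "y \<in> X" "dist (g a) y + dist y x = dist (g a) x" for x y
    proof -
      have "x \<in> g ` X" "y \<in> g ` X" unfolding gX by (rule xy)+
      then obtain x0 y0 where 0: "x0 \<in> X" "x = g x0" "y0 \<in> X" "y = g y0" by (elim imageE)
      have "real n < dist x0 b"
        using xy(2) g(2) iso[OF 0(1) b, folded 0(2)] dist_triangle[of x b' "g b"] by linarith
      then have "\<rho> + \<Delta> < dist y0 b"
        using n[OF 0(1,3)] xy(4) iso[OF a 0(3)] iso[OF 0(3,1)] iso[OF a 0(1)] unfolding 0(2,4) by simp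
      then show ?thesis
        using g(2) iso[OF 0(3) b, folded 0(4)] dist_triangle[of y "g b" b'] dist_commute[of b' "g b"]
        by linarith
    qed
    ultimately show "\<exists>a\<in>X. \<rho> < dist a b' \<and>
       (\<forall>x\<in>X. real n + \<Delta> < dist x b' \<longrightarrow> (\<forall>y\<in>X. dist a y + dist y x = dist a x \<longrightarrow> \<rho> < dist y b'))"
      using imageI[OF a, of g] unfolding gX by blast
  qed
qed

section \<open>Almost geodesic completeness\<close>

theorem theorem5:
  fixes X :: "'a::metric_space set"
  assumes "CAT0_space X"
    and "proper_space X"
    and "cocompact_space X"
    and "\<not> compact X"
  shows "almost_geodesically_complete X"
proof (rule ccontr)
  assume not_agc: "\<not> almost_geodesically_complete X"
  have geo: "geodesic_space X" and "X \<noteq> {}" using assms(1) by (simp_all add: CAT0_space_def)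
  obtain V where VX: "V \<subseteq> X" and sep: "\<And>u v. u \<in> V \<Longrightarrow> v \<in> V \<Longrightarrow> u \<noteq> v \<Longrightarrow> 1 \<le> dist u v"
    and dense: "\<And>x. x \<in> X \<Longrightarrow> \<exists>v\<in>V. dist x v \<le> 1"
    using separated_net_exists[of X] by blast
  note unif = separated_uniformly_finite[OF assms(2,3) VX sep]
  obtain m where m: "\<And>b. b \<in> X \<Longrightarrow> finite (V \<inter> cball b 3) \<and> card (V \<inter> cball b 3) \<le> m"
    using unif[of 3] by blast
  have dim: "card S \<le> m" if S: "S \<in> rips V" for S
  proof (cases "S = {}")
    case False
    then obtain b where b: "b \<in> S" by blast
    then have "b \<in> X" using rips_subset[OF S] VX by blast
    moreover have "S \<subseteq> V \<inter> cball b 3" using rips_dist[OF S b] rips_subset[OF S] by auto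
    ultimately show ?thesis using m card_mono by (meson order_trans)
  qed simp
  have locfin: "finite (V \<inter> cball x r)" for x r
  proof (cases "V \<inter> cball x r = {}")
    case False
    then obtain v where v: "v \<in> V" "dist x v \<le> r" by auto
    have "dist v w \<le> 2 * r" if "dist x w \<le> r" for w
      using that v(2) dist_triangle[of v w x] by (simp add: dist_commute)
    then have "V \<inter> cball x r \<subseteq> V \<inter> cball v (2 * r)" by auto
    moreover have "finite (V \<inter> cball v (2 * r))" using unif[of "2 * r"] v VX by blast
    ultimately show ?thesis by (rule finite_subset)
  qed simp
  have "V \<noteq> {}" using dense \<open>X \<noteq> {}\<close> by blast
  define q where "q x = (SOME v. v \<in> V \<and> dist x v \<le> 1)" for x
  have q: "q x \<in> V \<and> dist x (q x) \<le> 1" if "x \<in> X" for x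
    unfolding q_def by (rule someI_ex) (use dense[OF that] in blast)
  define \<delta> :: real where "\<delta> = 1 / 2 ^ Suc m"
  have \<delta>: "0 < \<delta>" by (simp add: \<delta>_def)
  interpret net_with_contractions X V q "\<lambda>a k. contract X a (\<delta> * real k)" m \<delta>
  proof
    fix a x k assume a: "a \<in> X" and x: "x \<in> X"
    have k: "0 \<le> \<delta> * real k" "0 \<le> \<delta> * real (Suc k)" for k using \<delta> by simp_all
    note c = contract_props[OF geo a x k(1)[of k] k(2)[of k]]
    show "contract X a (\<delta> * real k) x \<in> X" by (rule c)
    show "contract X a (\<delta> * real 0) x = a" using c(2) by simp
    show "dist (contract X a (\<delta> * real k) x) (contract X a (\<delta> * real (Suc k)) x) \<le> \<delta>"
      using c(6) \<delta> by (simp add: algebra_simps)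
    show "dist a (contract X a (\<delta> * real k) x) + dist (contract X a (\<delta> * real k) x) x = dist a x"
      using c(4,5) by simp
    show "dist a x \<le> \<delta> * real k \<Longrightarrow> contract X a (\<delta> * real k) x = x" by (rule c(3))
    fix y assume "y \<in> X"
    then show "dist (contract X a (\<delta> * real k) x) (contract X a (\<delta> * real k) y) \<le> dist x y"
      using contract_lipschitz[OF assms(1) a x _ k(1)] by blast
  qed (use VX q dim \<delta> in \<open>simp_all add: \<delta>_def\<close>)
  show False
    by (rule no_bounded_shadows[OF locfin \<open>V \<noteq> {}\<close> bounded_shadows[OF geo assms(2-4) not_agc]])
qed

end
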